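(* Let $n \ge 3$ be an integer and let $\mathbb{F}$ be any field. Let $\Omega_1$ be the set of $1$-dimensional subspaces of $\mathbb{F}^n$. Then the following hold. (i) $$\mathrm{RC}(\mathrm{PGL}_n(\mathbb{F}),\Omega_1)=\begin{cases} n & \text{if } |\mathbb{F}|\le 3,\\ n+2 & \text{if } |\mathbb{F}|\ge 4.\end{cases}$$ (ii) If $\overline{H}$ is a group with $\mathrm{PSL}_n(\mathbb{F}) \trianglelefteq \overline{H} < \mathrm{PGL}_n(\mathbb{F})$ (proper subgroup), then $$\mathrm{RC}(\overline{H},\Omega_1)=\begin{cases} 2n-1 & \text{if } n=3,\\ 2n-2 & \text{if } n\ge 4.\end{cases}$$
   Context: Relational complexity: let a group $H$ act on a set $\Omega$ (on the right, $x\mapsto x^h$). For $X=(x_1,\ldots,x_k),\,Y=(y_1,\ldots,y_k)\in\Omega^k$ and $r\le k$, say that $X$ and $Y$ are $r$-equivalent under $H$ if for every $r$-subset $\{i_1,\ldots,i_r\}\subseteq\{1,\ldots,k\}$ there exists $h\in H$ with $(x_{i_1}^h,\ldots,x_{i_r}^h)=(y_{i_1},\ldots,y_{i_r})$. The relational complexity $\mathrm{RC}(H,\Omega)$ is the smallest $r\ge 1$ such that, for all $k\ge r$ and all $X,Y\in\Omega^k$, $r$-equivalence of $X$ and $Y$ under $H$ implies $Y\in X^H$ (i.e. some single $h\in H$ maps $X$ to $Y$ entrywise). The groups $\mathrm{PSL}_n(\mathbb{F})\le\mathrm{PGL}_n(\mathbb{F})$ act on $\Omega_1$ in the natural way. The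 field $\mathbb{F}$ may be infinite. *)

theory Defs
  imports "HOL-Analysis.Determinants" "HOL-Algebra.Coset" "HOL-Library.Extended_Nat"
begin

section \<open>Relational complexity\<close>

text \<open>
  A group acting on the right is given by its set \<open>H\<close> of elements and the map
  \<open>act x h\<close>, standing for $x^h$. Tuples in $\Omega^k$ are lists over \<open>\<Omega>\<close> of length \<open>k\<close>,
  with positions counted from \<open>0\<close>.
\<close>

definition equivalent_under ::
    "'g set \<Rightarrow> ('x \<Rightarrow> 'g \<Rightarrow> 'x) \<Rightarrow> nat \<Rightarrow> 'x list \<Rightarrow> 'x list \<Rightarrow> bool" where
  "equivalent_under H act r X Y \<longleftrightarrow> length X = length Y \<and>
     (\<forall>I \<subseteq> {..<length X}. card I = r \<longrightarrow> (\<exists>h\<in>H. \<forall>i\<in>I. act (X ! i) h = Y ! i))"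

text \<open>The infimum is \<open>\<infinity>\<close> if there is no such \<open>r\<close>, and attained otherwise.\<close>

definition relational_complexity :: "'g set \<Rightarrow> ('x \<Rightarrow> 'g \<Rightarrow> 'x) \<Rightarrow> 'x set \<Rightarrow> enat" where
  "relational_complexity H act \<Omega> =
     Inf {enat r | r. 1 \<le> r \<and>
       (\<forall>k\<ge>r. \<forall>X\<in>lists \<Omega>. \<forall>Y\<in>lists \<Omega>.
          length X = k \<longrightarrow> length Y = k \<longrightarrow> equivalent_under H act r X Y \<longrightarrow>
          (\<exists>h\<in>H. map (\<lambda>x. act x h) X = Y))}"


section \<open>Projective linear groups and their action on projective points\<close>

definition GL :: "('a::field^'n^'n) monoid" where
  "GL = \<lparr>carrier = {A. invertible A}, mult = (**), one = mat 1\<rparr>"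

definition scalar_matrices :: "('a::field^'n^'n) set" where
  "scalar_matrices = {mat c | c. c \<noteq> 0}"

definition SL :: "('a::field^'n^'n) set" where
  "SL = {A. det A = 1}"

definition PGL :: "('a::field^'n^'n) set monoid" where
  "PGL = GL Mod scalar_matrices"

text \<open>
  \<open>PSL\<close> is the image of \<open>SL\<close> in \<open>PGL\<close>, which is how the quotient of \<open>SL\<close> by its scalar
  matrices is regarded as a subgroup of \<open>PGL\<close>.
\<close>

definition PSL :: "('a::field^'n^'n) set set" where
  "PSL = (\<lambda>A. scalar_matrices #>\<^bsub>GL\<^esub> A) ` SL"

definition proj_points :: "('a::field^'n) set set" where
  "proj_points = {W. vec.subspace W \<and> vec.dim W = 1}"

text \<open>
  Elements of \<open>PGL\<close> are cosets of scalar matrices. All matrices in a coset move a subspace to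
  the same subspace (lemma \<open>proj_act_coset\<close>), so the union over the coset is just that subspace.
\<close>

definition proj_act :: "('a::field^'n) set \<Rightarrow> ('a^'n^'n) set \<Rightarrow> ('a^'n) set" where
  "proj_act W C = {v v* A | v A. v \<in> W \<and> A \<in> C}"

lemma group_GL: "group (GL :: ('a::field^'n^'n) monoid)"
proof (rule groupI)
  fix A :: "'a^'n^'n" assume "A \<in> carrier GL"
  then obtain B where "A ** B = mat 1" "B ** A = mat 1"
    by (auto simp: GL_def invertible_def)
  then show "\<exists>y\<in>carrier GL. y \<otimes>\<^bsub>GL\<^esub> A = \<one>\<^bsub>GL\<^esub>"
    by (auto simp: GL_def invertible_def)
next
  show "\<one>\<^bsub>GL\<^esub> \<in> carrier (GL :: ('a^'n^'n) monoid)"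
    by (auto simp: GL_def invertible_def intro!: exI[of _ "mat 1"])
qed (auto simp: GL_def matrix_mul_assoc invertible_mult)

lemma mat_mult_left: "mat c ** (A :: 'a::field^'n^'n) = (\<chi> i j. c * A $ i $ j)"
  by (simp add: matrix_matrix_mult_def mat_def vec_eq_iff if_distrib[of "\<lambda>x. x * _"] sum.delta
      cong: if_cong)

lemma mat_mult_right: "(A :: 'a::field^'n^'n) ** mat c = (\<chi> i j. c * A $ i $ j)"
  by (simp add: matrix_matrix_mult_def mat_def vec_eq_iff if_distrib[of "\<lambda>x. _ * x"] sum.delta
      mult.commute cong: if_cong)

lemma scalar_matrices_normal: "scalar_matrices \<lhd> (GL :: ('a::field^'n^'n) monoid)"
proof -
  interpret group "GL :: ('a^'n^'n) monoid" by (rule group_GL)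
  have mm: "(mat c :: 'a^'n^'n) ** mat d = mat (c * d)" for c d
    unfolding mat_mult_left by (simp add: mat_def vec_eq_iff)
  have inv: "mat c \<in> carrier (GL :: ('a^'n^'n) monoid)" if "c \<noteq> 0" for c
    using that by (auto simp: GL_def invertible_def mm intro!: exI[of _ "mat (inverse c)"])
  have "subgroup scalar_matrices (GL :: ('a^'n^'n) monoid)"
  proof (rule subgroupI)
    show "scalar_matrices \<subseteq> carrier (GL :: ('a^'n^'n) monoid)"
      using inv by (auto simp: scalar_matrices_def)
    fix S :: "'a^'n^'n" assume "S \<in> scalar_matrices"
    then obtain c where c: "c \<noteq> 0" "S = mat c" by (auto simp: scalar_matrices_def)
    have "mat (inverse c) \<otimes>\<^bsub>GL\<^esub> S = \<one>\<^bsub>GL\<^esub>"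
      using c by (simp add: GL_def mm)
    then have "inv\<^bsub>GL\<^esub> S = mat (inverse c)"
      using c inv by (intro inv_equality) auto
    then show "inv\<^bsub>GL\<^esub> S \<in> scalar_matrices"
      using c by (auto simp: scalar_matrices_def)
  qed (auto simp: scalar_matrices_def GL_def mm intro: exI[of _ 1])
  then show ?thesis
    by (intro normalI)
      (auto simp: r_coset_def l_coset_def scalar_matrices_def GL_def mat_mult_left mat_mult_right)
qed

lemma group_PGL: "group (PGL :: ('a::field^'n^'n) set monoid)"
  unfolding PGL_def by (intro normal.factorgroup_is_group scalar_matrices_normal)

lemma proj_act_coset:
  fixes A :: "'a::field^'n^'n"
  assumes "vec.subspace W"
  shows "proj_act W (scalar_matrices #>\<^bsub>GL\<^esub> A) = (\<lambda>v. v v* A) ` W"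
proof -
  have *: "v v* (mat c ** A) = (c *s v) v* A" for c and v :: "'a^'n"
    by (simp add: mat_mult_left vector_matrix_mult_def vec_eq_iff ac_simps)
  have "proj_act W (scalar_matrices #>\<^bsub>GL\<^esub> A) = {(c *s v) v* A | v c. v \<in> W \<and> c \<noteq> 0}"
    unfolding proj_act_def r_coset_def scalar_matrices_def GL_def by (auto simp: * ) (metis * )+
  also have "\<dots> = (\<lambda>v. v v* A) ` W"
    using vec.subspace_scale[OF assms] by (auto simp: image_iff) (metis vector_smult_lid one_neq_zero)
  finally show ?thesis .
qed

end

theory Submission imports Defs begin

text \<open>
  Upper bounds. Points are treated as vectors up to scalars. Suppose that \<open>Z\<close> is fixed pointwise
  and one more point \<open>x\<close> has to be moved to \<open>y\<close>. Choose a basis \<open>B \<subseteq> Z\<close> and join two elements of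
  \<open>B\<close> if some point of \<open>Z\<close> involves both; the maps fixing \<open>Z\<close> are the diagonal ones that are constant
  on components. If no such map takes \<open>x\<close> to \<open>y\<close>, then there are \<open>i, j\<close> in one component at which the
  coordinate ratios of \<open>y\<close> and \<open>x\<close> disagree; take them at minimal distance. A shortest path from \<open>i\<close>
  to \<open>j\<close>, the points of \<open>Z\<close> that realise its edges and the basis elements off the path form a set of
  at most \<open>n + 1\<close> points which already obstructs \<open>x \<mapsto> y\<close> (even \<open>n - 1\<close> points when \<open>|F| \<le> 3\<close>,
  where it is enough to know whether one determinant vanishes). So \<open>(n+2)\<close>-equivalent tuples are
  conjugate in \<open>PGL\<close>. For a subgroup one uses in addition that the pointwise stabilizer of any set of
  points is that of at most \<open>2n - 2\<close> of them.

  Lower bounds. \<open>PGL\<close> needs \<open>n + 2\<close> points to see a cross-ratio. A group \<open>H\<close> between \<open>PSL\<close> and \<open>PGL\<close>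
  is described by the set \<open>D\<close> of its determinants, a proper subset of \<open>F\<^sup>*\<close> containing all \<open>n\<close>-th
  powers. The \<open>2n - 2\<close> points \<open>e\<^sub>i\<close> and \<open>e\<^sub>i + e\<^sub>o\<close> (\<open>i \<noteq> o\<close>) have only scalar stabilizer, but
  the stabilizer of any \<open>2n - 3\<close> of them has all determinants.
\<close>

section \<open>Vectors up to scalars and linear isomorphisms\<close>

text \<open>For nonzero vectors this means spanning the same projective point. Zero is related only
  to itself, so the upper bounds can be argued for arbitrary vectors.\<close>

definition par :: "'a::field^'n \<Rightarrow> 'a^'n \<Rightarrow> bool" where
  "par u w \<longleftrightarrow> (\<exists>c. c \<noteq> 0 \<and> u = c *s w)"

lemma par_refl [simp]: "par u u"
  unfolding par_def by (rule exI[of _ 1]) simp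

lemma par_scale: "c \<noteq> 0 \<Longrightarrow> par (c *s u) u"
  unfolding par_def by blast

lemma par_sym: "par u w \<Longrightarrow> par w u"
  unfolding par_def by (metis nonzero_imp_inverse_nonzero vec.scale_scale left_inverse vec.scale_one)

lemma par_trans: "par u v \<Longrightarrow> par v w \<Longrightarrow> par u w"
  unfolding par_def by (metis mult_eq_0_iff vec.scale_scale)

lemma par_in_span: "par u w \<Longrightarrow> w \<in> vec.span S \<Longrightarrow> u \<in> vec.span S"
  unfolding par_def by (auto intro: vec.span_scale)

abbreviation lin :: "('a::field^'n \<Rightarrow> 'a^'n) \<Rightarrow> bool" where
  "lin \<equiv> Vector_Spaces.linear (*s) (*s)"

lemma lin_I:
  assumes "\<And>u v. f (u + v) = f u + f v" "\<And>c v. f (c *s v) = c *s f v" shows "lin f"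
  using assms by unfold_locales (simp_all add: vec.scale_right_distrib vec.scale_left_distrib)

lemma invertible_transpose:
  fixes A :: "'a::field^'n^'n"
  assumes "invertible A" shows "invertible (transpose A)"
  using assms unfolding invertible_def by (metis matrix_transpose_mul transpose_mat)

text \<open>In finite dimension an injective endomorphism is bijective, so these are exactly the
  maps given by invertible matrices.\<close>

definition lin_iso :: "('a::field^'n \<Rightarrow> 'a^'n) \<Rightarrow> bool" where
  "lin_iso f \<longleftrightarrow> lin f \<and> inj f"

lemma lin_iso_par: "lin_iso f \<Longrightarrow> par u w \<Longrightarrow> par (f u) (f w)"
  unfolding lin_iso_def par_def by (auto simp: vec.linear_scale)

lemma lin_iso_comp: "lin_iso f \<Longrightarrow> lin_iso g \<Longrightarrow> lin_iso (\<lambda>x. f (g x))"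
  using Vector_Spaces.linear_compose[of "(*s)" "(*s)" g "(*s)" f] inj_compose[of f g]
  by (auto simp: lin_iso_def comp_def)

lemma lin_iso_inverse:
  assumes "lin_iso f" obtains g where "lin_iso g" "\<And>x. g (f x) = x" "\<And>x. f (g x) = x"
proof -
  have lf: "lin f" and i: "inj f" using assms by (auto simp: lin_iso_def)
  then have "surj f" by (rule vec.linear_injective_imp_surjective) (rule refl)
  have "lin (inv_into UNIV f)" using lf i by (rule vec.inj_linear_imp_inv_linear)
  moreover have "inj (inv_into UNIV f)" using \<open>surj f\<close> by (rule surj_imp_inj_inv)
  ultimately show thesis using that[of "inv_into UNIV f"] i \<open>surj f\<close>
    by (auto simp: lin_iso_def surj_f_inv_f)
qed

lemma lin_iso_matrix:
  fixes f :: "'a::field^'n \<Rightarrow> 'a^'n"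
  shows "lin_iso f \<longleftrightarrow> (\<exists>A. invertible A \<and> f = (\<lambda>v. v v* A))"
proof
  assume "lin_iso f"
  then have l: "lin f" and i: "inj f" by (auto simp: lin_iso_def)
  have e: "f v = v v* transpose (matrix f)" for v
    using matrix_works[OF l, of v] by simp
  have "(*v) (matrix f) = f" using matrix_works[OF l] by auto
  then have "invertible (matrix f)"
    using i matrix_left_invertible_injective[of "matrix f"] by (auto simp: invertible_left_inverse)
  then have "invertible (transpose (matrix f))" by (rule invertible_transpose)
  with e show "\<exists>A. invertible A \<and> f = (\<lambda>v. v v* A)" by blast
next
  assume "\<exists>A. invertible A \<and> f = (\<lambda>v. v v* A)"
  then obtain A where A: "invertible A" and f: "f = (\<lambda>v. v v* A)" by blast
  have f': "f = (*v) (transpose A)" using f by auto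
  have "invertible (transpose A)" using A by (rule invertible_transpose)
  then have "inj f" 
    unfolding f' using matrix_left_invertible_injective[of "transpose A"] by (auto simp: invertible_left_inverse)
  moreover have "lin f" unfolding f' by (rule matrix_vector_mul_linear_gen)
  ultimately show "lin_iso f" by (simp add: lin_iso_def)
qed

text \<open>Rescaling generators by nonzero factors keeps their span, so \<open>f\<close> maps the
  span of \<open>I\<close> onto itself, and injectivity keeps all other vectors outside. This is the
  invariant behind the obstructions in \<open>extend_par\<close>.\<close>

lemma lin_iso_span_iff:
  assumes f: "lin_iso f" and I: "finite I" "\<And>u. u \<in> I \<Longrightarrow> par (f u) u"
  shows "f v \<in> vec.span I \<longleftrightarrow> v \<in> vec.span I"
proof -
  have l: "lin f" and inj: "inj f" using f by (auto simp: lin_iso_def)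
  obtain c where c: "c u \<noteq> 0" "f u = c u *s u" if "u \<in> I" for u
    using I unfolding par_def by metis
  have "f ` vec.span I = vec.span (f ` I)" using l by (simp add: vec.linear_span_image)
  also have "f ` I = (\<lambda>u. c u *s u) ` I" using c by auto
  also have "vec.span \<dots> = vec.span I" using I c by (simp add: vec.span_image_scale)
  finally show ?thesis using inj by (metis inj_image_mem_iff)
qed

section \<open>Coordinates\<close>

locale vec_basis =
  fixes E :: "('a::field^'n) set"
  assumes indep: "vec.independent E" and span_E [simp]: "vec.span E = UNIV"
begin

definition coord :: "'a^'n \<Rightarrow> 'a^'n \<Rightarrow> 'a" where
  "coord v = vec.representation E v"

lemma finite_E [simp]: "finite E"
  using indep by (rule vec.finiteI_independent)

lemma coord_add: "coord (u + v) b = coord u b + coord v b"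
  by (simp add: coord_def vec.representation_add indep)

lemma coord_scale: "coord (c *s v) b = c * coord v b"
  by (simp add: coord_def vec.representation_scale indep)

lemma coord_0 [simp]: "coord 0 b = 0"
  by (simp add: coord_def vec.representation_zero)

lemma coord_sum: "coord (sum f I) b = (\<Sum>i\<in>I. coord (f i) b)"
  by (simp add: coord_def vec.representation_sum indep)

lemma coord_basis: "b \<in> E \<Longrightarrow> coord b c = (if c = b then 1 else 0)"
  by (simp add: coord_def vec.representation_basis indep)

lemma coord_outside: "b \<notin> E \<Longrightarrow> coord v b = 0"
  unfolding coord_def using vec.representation_ne_zero by blast

lemma sum_coord: "(\<Sum>b\<in>E. coord v b *s b) = v"
  unfolding coord_def by (rule vec.sum_representation_eq) (auto simp: indep)

lemma coord_eqI: "(\<And>b. b \<in> E \<Longrightarrow> coord u b = coord v b) \<Longrightarrow> u = v"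
  using sum_coord[of u] sum_coord[of v] by (metis (no_types, lifting) sum.cong)

lemma span_iff: "P \<subseteq> E \<Longrightarrow> v \<in> vec.span P \<longleftrightarrow> (\<forall>b. b \<notin> P \<longrightarrow> coord v b = 0)"
proof
  assume P: "P \<subseteq> E" "v \<in> vec.span P"
  have "coord v = vec.representation P v"
    unfolding coord_def using vec.representation_extend[OF indep] P by simp
  then show "\<forall>b. b \<notin> P \<longrightarrow> coord v b = 0" using vec.representation_ne_zero by metis
next
  assume P: "P \<subseteq> E" "\<forall>b. b \<notin> P \<longrightarrow> coord v b = 0"
  have "(\<Sum>b\<in>E. coord v b *s b) \<in> vec.span P"
  proof (rule vec.span_sum)
    fix b assume "b \<in> E"
    show "coord v b *s b \<in> vec.span P" using P
      by (cases "b \<in> P") (auto intro: vec.span_scale vec.span_base vec.span_zero)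
  qed
  then show "v \<in> vec.span P" by (simp add: sum_coord)
qed

lemma coord_sum_basis: "P \<subseteq> E \<Longrightarrow> coord (\<Sum>b\<in>P. t b *s b) c = (if c \<in> P then t c else 0)"
proof -
  assume P: "P \<subseteq> E"
  then have f: "finite P" by (rule finite_subset) simp
  have "coord (\<Sum>b\<in>P. t b *s b) c = (\<Sum>b\<in>P. if c = b then t b else 0)"
    using P by (auto simp: coord_sum coord_scale coord_basis intro!: sum.cong)
  then show ?thesis using f by (simp add: sum.delta')
qed

definition diag :: "('a^'n \<Rightarrow> 'a) \<Rightarrow> 'a^'n \<Rightarrow> 'a^'n" where
  "diag t v = (\<Sum>b\<in>E. (t b * coord v b) *s b)"

lemma coord_diag: "coord (diag t v) b = t b * coord v b"
  unfolding diag_def using coord_outside[of b] by (simp add: coord_sum_basis)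

lemma lin_iso_diag:
  assumes "\<And>b. b \<in> E \<Longrightarrow> t b \<noteq> 0" shows "lin_iso (diag t)"
proof -
  have "lin (diag t)"
    by (rule lin_I) (auto intro!: coord_eqI simp: coord_diag coord_add coord_scale algebra_simps)
  moreover have "inj (diag t)"
  proof (rule injI)
    fix u v assume "diag t u = diag t v"
    then have "t b * coord u b = t b * coord v b" for b by (metis coord_diag)
    then show "u = v" using assms by (intro coord_eqI) (metis mult_left_cancel)
  qed
  ultimately show ?thesis by (simp add: lin_iso_def)
qed

lemma diag_eigen:
  assumes "\<And>b. b \<in> E \<Longrightarrow> coord v b \<noteq> 0 \<Longrightarrow> t b = c" shows "diag t v = c *s v"
proof (rule coord_eqI)
  fix b assume "b \<in> E"
  then show "coord (diag t v) b = coord (c *s v) b"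
    using assms[of b] by (cases "coord v b = 0") (auto simp: coord_diag coord_scale)
qed

end

lemma vec_basis_card:
  fixes E :: "('a::field^'n) set"
  assumes "vec_basis E" shows "card E = CARD('n)"
  using vec.dim_span_eq_card_independent[of E] assms vec_dim_card[where 'a='a and 'n='n]
  unfolding vec_basis_def by metis

lemma vec_basis_extend:
  assumes "vec.independent B" obtains E where "vec_basis E" "B \<subseteq> E"
  using vec.extend_basis_superset[OF assms] vec.independent_extend_basis[OF assms] vec.span_extend_basis[OF assms]
  by (auto simp: vec_basis_def)

section \<open>Tuples with equivalent subtuples\<close>

lemma (in vec_basis) span_Diff_I:
  assumes "B \<subseteq> E" "\<And>c. c \<notin> B \<Longrightarrow> coord w c = 0" "\<And>c. c \<in> P \<Longrightarrow> coord w c = 0"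
  shows "w \<in> vec.span (B - P)"
  using assms by (subst span_iff) auto

text \<open>
  \<open>U\<close> spans a hyperplane of \<open>span B\<close>; its equation has nonzero coefficients exactly along the path,
  obtained by solving the equation at \<open>z q\<close> for the coefficient at \<open>p (Suc q)\<close>.
\<close>

lemma (in vec_basis) span_path_iff:
  fixes p z :: "nat \<Rightarrow> 'a^'n" and l :: nat
  assumes B: "B \<subseteq> E" and inj: "inj_on p {..l}" and pB: "p ` {..l} \<subseteq> B"
    and zB: "\<And>q b. q < l \<Longrightarrow> b \<notin> B \<Longrightarrow> coord (z q) b = 0"
    and z0: "\<And>q s. q < l \<Longrightarrow> s \<le> l \<Longrightarrow> coord (z q) (p s) \<noteq> 0 \<longleftrightarrow> s = q \<or> s = Suc q"
  defines "U \<equiv> (B - p ` {..l}) \<union> z ` {..<l}"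
  obtains g where "\<And>q. q \<le> l \<Longrightarrow> g q \<noteq> (0::'a)"
    "\<And>v. (\<And>b. b \<notin> B \<Longrightarrow> coord v b = 0) \<Longrightarrow> v \<in> vec.span U \<longleftrightarrow> (\<Sum>q\<le>l. g q * coord v (p q)) = 0"
proof -
  define g where "g = rec_nat (1::'a) (\<lambda>q a. - (a * coord (z q) (p q) / coord (z q) (p (Suc q))))"
  have g0: "g 0 = 1" and gS: "g (Suc q) = - (g q * coord (z q) (p q) / coord (z q) (p (Suc q)))" for q
    by (simp_all add: g_def)
  have gnz: "g q \<noteq> 0" if "q \<le> l" for q
    using that
  proof (induction q)
    case (Suc q)
    then show ?case using z0[of q q] z0[of q "Suc q"] by (simp add: gS)
  qed (simp add: g0)
  define \<phi> where "\<phi> v = (\<Sum>q\<le>l. g q * coord v (p q))" for v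
  have sub: "vec.subspace {v. \<phi> v = 0}"
    by (rule vec.subspaceI)
      (auto simp: \<phi>_def coord_add coord_scale sum.distrib distrib_left mult.left_commute simp flip: sum_distrib_left)
  have \<phi>z: "\<phi> (z q) = 0" if q: "q < l" for q
  proof -
    have "\<phi> (z q) = (\<Sum>s\<in>{q, Suc q}. g s * coord (z q) (p s))"
      unfolding \<phi>_def by (rule sum.mono_neutral_right) (use q z0[OF q] in auto)
    also have "\<dots> = 0" using z0[OF q, of "Suc q"] q by (simp add: gS)
    finally show ?thesis .
  qed
  have \<phi>W: "\<phi> b = 0" if "b \<in> B - p ` {..l}" for b
    unfolding \<phi>_def using that B by (intro sum.neutral) (auto simp: coord_basis subsetD[OF B])
  have "vec.span U \<subseteq> {v. \<phi> v = 0}"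
    by (rule vec.span_minimal) (auto simp: U_def \<phi>z \<phi>W sub)
  then have U0: "\<phi> v = 0" if "v \<in> vec.span U" for v using that by auto
  have \<phi>p0: "\<phi> (p 0) = 1"
  proof -
    have "\<phi> (p 0) = (\<Sum>q\<le>l. if q = 0 then 1 else 0)"
      unfolding \<phi>_def
    proof (rule sum.cong)
      fix q assume "q \<in> {..l}"
      moreover have "p 0 \<in> E" using pB B by auto
      ultimately show "g q * coord (p 0) (p q) = (if q = 0 then 1 else 0)"
        using inj by (auto simp: coord_basis g0 inj_on_def)
    qed simp
    then show ?thesis by simp
  qed
  \<comment> \<open>Once \<open>p 0\<close> is adjoined, the path is recovered step by step:
    \<open>z q\<close> minus its two path components involves only basis vectors off the path, so
    \<open>p (Suc q)\<close> is a combination of \<open>p q\<close> and elements of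
    \<open>U\<close>.\<close>
  have pU: "p q \<in> vec.span (insert (p 0) U)" if "q \<le> l" for q
    using that
  proof (induction q)
    case 0
    then show ?case by (simp add: vec.span_base)
  next
    case (Suc q)
    let ?a = "coord (z q) (p q)" and ?b = "coord (z q) (p (Suc q))"
    define w where "w = z q - ?a *s p q - ?b *s p (Suc q)"
    have bnz: "?b \<noteq> 0" using z0[of q "Suc q"] Suc by simp
    have pE: "p s \<in> E" if "s \<le> l" for s using that pB B by auto
    have pp: "p s = p s' \<longleftrightarrow> s = s'" if "s \<le> l" "s' \<le> l" for s s'
      using inj that by (auto simp: inj_on_def)
    have cw: "coord w c = coord (z q) c - ?a * coord (p q) c - ?b * coord (p (Suc q)) c" for c
    proof -
      have "w = z q + (- ?a) *s p q + (- ?b) *s p (Suc q)" by (simp add: w_def)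
      then show ?thesis by (simp only: coord_add coord_scale) simp
    qed
    have "w \<in> vec.span (B - p ` {..l})"
    proof (rule span_Diff_I[OF B])
      fix c assume c: "c \<notin> B"
      have "p q \<in> B" "p (Suc q) \<in> B" using pB Suc.prems by auto
      with c have "c \<noteq> p q" "c \<noteq> p (Suc q)" by auto
      with c show "coord w c = 0" using zB[of q c] Suc pE by (simp add: cw coord_basis)
    next
      fix c assume "c \<in> p ` {..l}"
      then obtain s where s: "s \<le> l" "c = p s" by auto
      then show "coord w c = 0" using z0[of q s] Suc pE pp
        by (auto simp: cw coord_basis)
    qed
    then have 1: "w \<in> vec.span (insert (p 0) U)"
      by (rule subsetD[OF vec.span_mono, rotated]) (auto simp: U_def)
    have 2: "z q \<in> vec.span (insert (p 0) U)"
      by (rule vec.span_base) (use Suc in \<open>auto simp: U_def\<close>)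
    have "?b *s p (Suc q) = z q - ?a *s p q - w" by (simp add: w_def)
    also have "\<dots> \<in> vec.span (insert (p 0) U)"
      using Suc 1 2 by (intro vec.span_diff vec.span_scale) auto
    finally have "inverse ?b *s (?b *s p (Suc q)) \<in> vec.span (insert (p 0) U)"
      by (rule vec.span_scale)
    then show ?case using bnz by simp
  qed
  have BU: "B \<subseteq> vec.span (insert (p 0) U)"
  proof
    fix b assume b: "b \<in> B"
    show "b \<in> vec.span (insert (p 0) U)"
    proof (cases "b \<in> p ` {..l}")
      case False
      then show ?thesis using b by (intro vec.span_base) (auto simp: U_def)
    qed (use pU in auto)
  qed
  show thesis
  proof (rule that[of g])
    show "g q \<noteq> 0" if "q \<le> l" for q using gnz that .
    fix v assume v: "\<And>b. b \<notin> B \<Longrightarrow> coord v b = 0"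
    then have "v \<in> vec.span B" using B by (simp add: span_iff)
    then have "v \<in> vec.span (insert (p 0) U)"
      using BU vec.span_minimal[OF BU vec.subspace_span] by blast
    \<comment> \<open>Since \<phi> vanishes on the span of \<open>U\<close> and is 1 at
      \<open>p 0\<close>, the coefficient \<open>k\<close> is the value of \<phi> at
      \<open>v\<close>.\<close>
    then obtain k where k: "v - k *s p 0 \<in> vec.span U" by (auto simp: vec.span_breakdown_eq)
    have "\<phi> (v - k *s p 0) = \<phi> v - k * \<phi> (p 0)"
    proof -
      have "\<phi> (v + (- k) *s p 0) = \<phi> v + (- k) * \<phi> (p 0)"
        unfolding \<phi>_def coord_add coord_scale
        by (simp add: algebra_simps sum.distrib sum_distrib_left sum_negf sum_subtractf)
      then show ?thesis by simp
    qed
    with U0[OF k] have "\<phi> v = k" by (simp add: \<phi>p0)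
    then show "v \<in> vec.span U \<longleftrightarrow> (\<Sum>q\<le>l. g q * coord v (p q)) = 0"
      using U0[of v] k unfolding \<phi>_def[symmetric] by auto
  qed
qed

text \<open>As \<open>s\<close> and \<open>t\<close> are 1 and -1 in some order,
  \<open>s = - t\<close> and the characteristic is not 2. Since \<open>b\<close> is \<open>a\<close>
  or \<open>- a\<close>, exactly one of \<open>a + b\<close> and \<open>(b - a) * t\<close>
  vanishes.\<close>

lemma ternary_sum_eq_0:
  fixes a b s t :: "'a::field"
  assumes F: "\<forall>a::'a. a = 0 \<or> a = 1 \<or> a = -1"
    and nz: "a \<noteq> 0" "b \<noteq> 0" "s \<noteq> 0" "t \<noteq> 0" "s \<noteq> t"
  shows "\<not> (a + b = 0 \<longleftrightarrow> a * s + b * t = 0)"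
proof -
  have st: "s = - t" using F[rule_format, of s] F[rule_format, of t] nz by auto
  have "(1::'a) \<noteq> -1" using F[rule_format, of s] F[rule_format, of t] nz by auto
  then have "a \<noteq> - a" using F[rule_format, of a] nz by auto
  moreover have "b = a \<or> b = - a" using F[rule_format, of a] F[rule_format, of b] nz by auto
  moreover have "a * s + b * t = (b - a) * t" by (simp add: st algebra_simps)
  ultimately show ?thesis using nz by (auto simp: eq_neg_iff_add_eq_0 add.commute)
qed

text \<open>Provides the inductive step of \<open>tuple_par\<close>. The strict bound on
  \<open>card I\<close> leaves room for \<open>x\<close> among \<open>r\<close> points; the second
  alternative of \<open>small\<close> covers fields with at most three elements.\<close>

lemma extend_par:
  fixes Z :: "('a::field^'n) set"
  assumes r: "CARD('n) \<le> r"
    and small: "CARD('n) + 2 \<le> r \<or> (\<forall>a::'a. a = 0 \<or> a = 1 \<or> a = -1)"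
    and hyp: "\<And>I. I \<subseteq> Z \<Longrightarrow> finite I \<Longrightarrow> card I < r \<Longrightarrow>
      \<exists>f. lin_iso f \<and> (\<forall>u\<in>I. par (f u) u) \<and> par (f x) y"
  shows "\<exists>f. lin_iso f \<and> (\<forall>u\<in>Z. par (f u) u) \<and> par (f x) y"
proof -
  obtain B where BZ: "B \<subseteq> Z" and Bi: "vec.independent B" and ZB: "Z \<subseteq> vec.span B"
    by (rule vec.maximal_independent_subset)
  obtain E where "vec_basis E" and BE: "B \<subseteq> E" using Bi by (rule vec_basis_extend)
  interpret vec_basis E by fact
  have card_E: "card E = CARD('n)" by (rule vec_basis_card) fact
  have fB: "finite B" using BE by (rule finite_subset) simp
  have cB: "card B \<le> CARD('n)" using card_mono[OF _ BE] card_E by simp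
  have full: "v \<in> vec.span B" if "\<not> card B < CARD('n)" for v
  proof -
    have "B = E" using that cB card_E BE by (intro card_subset_eq) auto
    then show ?thesis by simp
  qed
  show ?thesis
  proof (cases "x \<in> vec.span B")
    case False
    then have "card B < CARD('n)" using full by blast
    then obtain f where f: "lin_iso f" "\<And>u. u \<in> B \<Longrightarrow> par (f u) u" "par (f x) y"
      using hyp[OF BZ fB] r by auto
    then have lf: "lin f" by (simp add: lin_iso_def)
    obtain c where c: "c u \<noteq> 0" "f u = c u *s u" if "u \<in> B" for u
      using f(2) unfolding par_def by metis
    have xB: "x \<notin> B" using False vec.span_base by blast
    obtain E' where E': "vec_basis E'" "insert x B \<subseteq> E'"
      using vec.independent_insertI[OF False Bi] by (rule vec_basis_extend)
    interpret E': vec_basis E' by fact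
    \<comment> \<open>Precomposing \<open>f\<close> with this diagonal map cancels the scalars by
      which \<open>f\<close> acts on \<open>B\<close>. The composite is the identity on the span of
      \<open>B\<close>, hence on \<open>Z\<close>, and still takes \<open>x\<close> to
      \<open>f x\<close>.\<close>
    define t where "t b = (if b \<in> B then inverse (c b) else 1)" for b
    have d: "lin_iso (E'.diag t)" by (rule E'.lin_iso_diag) (auto simp: t_def c)
    have db: "E'.diag t b = t b *s b" if "b \<in> E'" for b
      using that by (intro E'.diag_eigen) (auto simp: E'.coord_basis split: if_splits)
    have fd: "lin_iso (\<lambda>v. f (E'.diag t v))" using f(1) d by (rule lin_iso_comp)
    moreover have "f (E'.diag t u) = id u" if "u \<in> Z" for u
    proof (rule vec.linear_eq_on[of "\<lambda>v. f (E'.diag t v)" id u B])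
      show "lin (\<lambda>v. f (E'.diag t v))" using fd by (simp add: lin_iso_def)
      show "lin (id :: 'a^'n \<Rightarrow> 'a^'n)" by (rule vec.linear_id)
      show "u \<in> vec.span B" using that ZB by blast
      fix b assume b: "b \<in> B"
      then have "b \<in> E'" using E' by blast
      then show "f (E'.diag t b) = id b" using b lf c
        by (simp add: db t_def vec.linear_scale)
    qed
    moreover have "E'.diag t x = x" using xB E' by (simp add: db t_def)
    ultimately show ?thesis using f(3) by (intro exI[of _ "\<lambda>v. f (E'.diag t v)"]) auto
  next
    case True
    have yB: "y \<in> vec.span B"
    proof (cases "card B < CARD('n)")
      case lt: True
      then obtain f where f: "lin_iso f" "\<And>u. u \<in> B \<Longrightarrow> par (f u) u" "par (f x) y"
        using hyp[OF BZ fB] r by auto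
      then show ?thesis using lin_iso_span_iff[OF f(1) fB f(2), of x] True par_in_span par_sym by blast
    qed (rule full)
    have x0: "coord x b = 0" and y0: "coord y b = 0" if "b \<notin> B" for b
      using True yB that BE by (auto simp: span_iff)
    have Z0: "coord z b = 0" if "z \<in> Z" "b \<notin> B" for z b
      using that ZB BE by (auto simp: span_iff)

    \<comment> \<open>Equality of the supports of \<open>x\<close> and \<open>y\<close>\<close>
    have supp: "coord x b = 0 \<longleftrightarrow> coord y b = 0" for b
    proof (cases "b \<in> B")
      case b: True
      have f0: "finite (B - {b})" using fB by simp
      have "card (B - {b}) < r" using b fB cB r card_Diff1_less[OF fB b] by linarith
      then obtain f where f: "lin_iso f" "\<And>u. u \<in> B - {b} \<Longrightarrow> par (f u) u" "par (f x) y"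
        using hyp[of "B - {b}"] BZ fB by auto
      have "coord v b = 0 \<longleftrightarrow> v \<in> vec.span (B - {b})" if "\<And>b. b \<notin> B \<Longrightarrow> coord v b = 0" for v
        using that BE by (subst span_iff) auto
      moreover have "x \<in> vec.span (B - {b}) \<longleftrightarrow> y \<in> vec.span (B - {b})"
        using lin_iso_span_iff[OF f(1) f0 f(2), of x] f(3) par_in_span par_sym by blast
      ultimately show ?thesis using x0 y0 by metis
    qed (simp add: x0 y0)

    \<comment> \<open>Constancy of the coordinate ratios on components\<close>
    define \<rho> where "\<rho> b = coord y b / coord x b" for b
    define R where "R = {(b, b'). b \<in> B \<and> b' \<in> B \<and> (\<exists>z\<in>Z. coord z b \<noteq> 0 \<and> coord z b' \<noteq> 0)}"
    have consistent: "\<rho> i = \<rho> j" if ij: "coord x i \<noteq> 0" "coord x j \<noteq> 0" "(i, j) \<in> R\<^sup>*" for i j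
    proof (rule ccontr)
      assume "\<rho> i \<noteq> \<rho> j"
      \<comment> \<open>The minimum is taken over all pairs with different ratios, not only over the
        paths from one \<open>i\<close> to one \<open>j\<close>. So the path has no shortcuts and,
        moreover, \<open>x\<close> vanishes at its inner vertices.\<close>
      define Q where "Q l \<longleftrightarrow> (\<exists>i j. coord x i \<noteq> 0 \<and> coord x j \<noteq> 0 \<and> \<rho> i \<noteq> \<rho> j \<and> (i, j) \<in> R ^^ l)" for l
      have "\<exists>l. Q l" using ij \<open>\<rho> i \<noteq> \<rho> j\<close> rtrancl_imp_relpow[OF ij(3)] unfolding Q_def by blast
      define l where "l = (LEAST l. Q l)"
      have "Q l" unfolding l_def using \<open>\<exists>l. Q l\<close> by (rule LeastI_ex)
      then obtain i j where i: "coord x i \<noteq> 0" and j: "coord x j \<noteq> 0" and ne: "\<rho> i \<noteq> \<rho> j"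
        and path: "(i, j) \<in> R ^^ l" unfolding Q_def by blast
      have min: "\<rho> i' = \<rho> j'" if "(i', j') \<in> R ^^ k" "k < l" "coord x i' \<noteq> 0" "coord x j' \<noteq> 0" for i' j' k
      proof -
        have "\<not> Q k" using that(2) unfolding l_def by (rule not_less_Least)
        then show ?thesis using that unfolding Q_def by blast
      qed
      obtain p where p0: "p 0 = i" and pl: "p l = j" and pR: "\<And>q. q < l \<Longrightarrow> (p q, p (Suc q)) \<in> R"
        using path unfolding relpow_fun_conv by blast
      have seg: "(p a, p (a + k)) \<in> R ^^ k" if "a + k \<le> l" for a k
        using that by (induction k) (auto intro!: relpow_Suc_I pR)
      have seg': "(p a, p b) \<in> R ^^ (b - a)" if "a \<le> b" "b \<le> l" for a b
        using seg[of a "b - a"] that by simp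
      have short: False if "(i, j) \<in> R ^^ k" "k < l" for k
        using min[OF that i j] ne by blast
      have shortcut: False if "a < b" "b \<le> l" "(p a, p b) \<in> R ^^ k" "k < b - a" for a b k
      proof -
        have "(i, p b) \<in> R ^^ a O R ^^ k" using seg'[of 0 a] that p0 by auto
        then have "(i, j) \<in> (R ^^ a O R ^^ k) O R ^^ (l - b)" using seg'[of b l] that pl by auto
        then have "(i, j) \<in> R ^^ (a + k + (l - b))" by (simp only: relpow_add)
        then show False using short that by force
      qed
      have l0: "0 < l" using ne p0 pl by (cases l) auto
      have inj: "inj_on p {..l}"
      proof (rule linorder_inj_onI)
        fix a b assume "a < b" "b \<in> {..l}"
        then show "p a \<noteq> p b" using shortcut[of a b 0] by auto
      qed auto
      have pB: "p ` {..l} \<subseteq> B"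
      proof clarify
        fix q assume "q \<le> l"
        then show "p q \<in> B" using pR[of q] pR[of "q - 1"] l0 by (cases "q = l") (auto simp: R_def)
      qed
      obtain z where zZ: "\<And>q. q < l \<Longrightarrow> z q \<in> Z"
        and z1: "\<And>q. q < l \<Longrightarrow> coord (z q) (p q) \<noteq> 0"
        and z2: "\<And>q. q < l \<Longrightarrow> coord (z q) (p (Suc q)) \<noteq> 0"
        using pR unfolding R_def by simp metis
      \<comment> \<open>A further path vertex in the support of \<open>z q\<close> would be joined
        by one edge to \<open>p q\<close> and to \<open>p (Suc q)\<close>, which shortens the
        path.\<close>
      have z0: "coord (z q) (p s) \<noteq> 0 \<longleftrightarrow> s = q \<or> s = Suc q" if q: "q < l" "s \<le> l" for q s
      proof (rule ccontr)
        assume *: "\<not> ?thesis"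
        then have nz: "coord (z q) (p s) \<noteq> 0" and s: "s < q \<or> Suc q < s" using z1 z2 q by auto
        from s show False
        proof
          assume "s < q"
          have "(p s, p (Suc q)) \<in> R" using nz z2[OF q(1)] zZ[OF q(1)] pB q by (auto simp: R_def)
          moreover have "1 < Suc q - s" using \<open>s < q\<close> by linarith
          ultimately show False using shortcut[of s "Suc q" 1] \<open>s < q\<close> q by simp
        next
          assume "Suc q < s"
          have "(p q, p s) \<in> R" using nz z1[OF q(1)] zZ[OF q(1)] pB q by (auto simp: R_def)
          moreover have "1 < s - q" using \<open>Suc q < s\<close> by linarith
          ultimately show False using shortcut[of q s 1] \<open>Suc q < s\<close> q by simp
        qed
      qed
      \<comment> \<open>By minimality, an inner vertex in the support of \<open>x\<close> would
        share its ratio with both ends.\<close>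
      have mid: "coord x (p q) = 0" if q: "0 < q" "q < l" for q
      proof (rule ccontr)
        assume nz: "coord x (p q) \<noteq> 0"
        have "\<rho> i = \<rho> (p q)" using min[OF seg'[of 0 q]] q nz i p0 by auto
        moreover have "\<rho> (p q) = \<rho> j" using min[OF seg'[of q l]] q nz j pl by auto
        ultimately show False using ne by simp
      qed
      define W where "W = B - p ` {..l}"
      define U where "U = W \<union> z ` {..<l}"
      have zB: "coord (z q) b = 0" if "q < l" "b \<notin> B" for q b using Z0 zZ that by blast
      obtain g where gnz: "\<And>q. q \<le> l \<Longrightarrow> g q \<noteq> (0::'a)"
        and gU: "\<And>v. (\<And>b. b \<notin> B \<Longrightarrow> coord v b = 0) \<Longrightarrow>
          v \<in> vec.span U \<longleftrightarrow> (\<Sum>q\<le>l. g q * coord v (p q)) = 0"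
        using span_path_iff[OF BE inj pB zB z0] unfolding U_def W_def by blast
      have ends: "(\<Sum>q\<le>l. g q * coord v (p q)) = g 0 * coord v i + g l * coord v j"
        if "\<And>q. 0 < q \<Longrightarrow> q < l \<Longrightarrow> coord v (p q) = 0" for v
      proof -
        have "(\<Sum>q\<le>l. g q * coord v (p q)) = (\<Sum>q\<in>{0, l}. g q * coord v (p q))"
          by (rule sum.mono_neutral_right) (use that in auto)
        then show ?thesis using l0 by (simp add: p0 pl)
      qed
      have UZ: "U \<subseteq> Z" using BZ zZ by (auto simp: U_def W_def)
      have fU: "finite U" using fB by (simp add: U_def W_def)
      have "card (p ` {..l}) = Suc l" using card_image[OF inj] by simp
      then have "card W + Suc l = card B"
        using card_Diff_subset[OF _ pB] card_mono[OF fB pB] by (simp add: W_def)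
      moreover have "card U \<le> card W + l"
        unfolding U_def using card_Un_le[of W "z ` {..<l}"] card_image_le[of "{..<l}" z] by simp
      \<comment> \<open>The \<open>l + 1\<close> path vertices are exchanged for at most
        \<open>l\<close> points.\<close>
      ultimately have cU: "Suc (card U) \<le> card B" by linarith
      show False
        using small
      proof
        assume r2: "CARD('n) + 2 \<le> r"
        \<comment> \<open>With both ends added there are at most \<open>card B + 1\<close> points of
          \<open>Z\<close>, hence at most \<open>CARD('n) + 2\<close> together with
          \<open>x\<close>.\<close>
        let ?I = "insert i (insert j U)"
        have "card ?I \<le> Suc (Suc (card U))" using fU by (simp add: card_insert_if)
        then have "card ?I < r" using cU cB r2 by linarith
        moreover have "?I \<subseteq> Z" using UZ BZ pB p0 pl l0 by auto
        ultimately obtain f where f: "lin_iso f" "\<And>u. u \<in> ?I \<Longrightarrow> par (f u) u" "par (f x) y"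
          using hyp[of ?I] fU by auto
        then have lf: "lin f" by (simp add: lin_iso_def)
        have iE: "i \<in> E" "j \<in> E" "i \<in> B" "j \<in> B" using pB p0 pl BE by auto
        have "i \<noteq> j" using ne by blast
        have pi: "p q = i \<longleftrightarrow> q = 0" and pj: "p q = j \<longleftrightarrow> q = l" if "q \<le> l" for q
          using inj that p0 pl by (auto simp: inj_on_def)
        obtain a b where a: "f i = a *s i" and b: "f j = b *s j"
          using f(2)[of i] f(2)[of j] by (auto simp: par_def)
        have "a = b"
        proof -
          have U1: "s *s i + t *s j \<in> vec.span U \<longleftrightarrow> g 0 * s + g l * t = 0" for s t
          proof -
            have cv: "coord (s *s i + t *s j) c = (if c = i then s else if c = j then t else 0)" for c
              using iE \<open>i \<noteq> j\<close> by (auto simp: coord_add coord_scale coord_basis)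
            have "s *s i + t *s j \<in> vec.span U \<longleftrightarrow> (\<Sum>q\<le>l. g q * coord (s *s i + t *s j) (p q)) = 0"
              by (rule gU) (use iE in \<open>auto simp: cv\<close>)
            also have "(\<Sum>q\<le>l. g q * coord (s *s i + t *s j) (p q)) = g 0 * s + g l * t"
              by (subst ends) (use pi pj \<open>i \<noteq> j\<close> in \<open>auto simp: cv\<close>)
            finally show ?thesis .
          qed
          \<comment> \<open>Up to a factor this is the only combination of \<open>i\<close> and
            \<open>j\<close> in the span of \<open>U\<close>. As \<open>f\<close> preserves that
            span, its eigenvalues at \<open>i\<close> and \<open>j\<close> agree.\<close>
          let ?v = "g l *s i + (- g 0) *s j"
          have "?v \<in> vec.span U" unfolding U1 by simp
          then have "f ?v \<in> vec.span U" using lin_iso_span_iff[OF f(1) fU f(2), of ?v] by auto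
          also have "f ?v = (g l * a) *s i + (- g 0 * b) *s j"
            by (simp only: vec.linear_add[OF lf] vec.linear_scale[OF lf] a b vec.scale_scale)
          finally have "g 0 * g l * (a - b) = 0" unfolding U1 by (simp add: algebra_simps)
          then show ?thesis using gnz[of 0] gnz[of l] by simp
        qed
        \<comment> \<open>The part of \<open>x\<close> away from both ends lies in the span of
          \<open>W\<close>, which \<open>f\<close> preserves. It contributes nothing to the
          coordinates of \<open>f x\<close> at \<open>i\<close> and \<open>j\<close>, so both are
          those of \<open>x\<close> multiplied by the same \<open>a\<close>.\<close>
        define w where "w = x + (- coord x i) *s i + (- coord x j) *s j"
        have cw: "coord w c = (if c = i \<or> c = j then 0 else coord x c)" for c
          using iE \<open>i \<noteq> j\<close> unfolding w_def coord_add coord_scale by (auto simp: coord_basis)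
        have "w \<in> vec.span W"
          unfolding W_def
        proof (rule span_Diff_I[OF BE])
          fix c assume "c \<notin> B" then show "coord w c = 0" by (auto simp: cw x0)
        next
          fix c assume "c \<in> p ` {..l}"
          then obtain q where "q \<le> l" "c = p q" by auto
          then show "coord w c = 0" using mid[of q] pi[of q] pj[of q] by (auto simp: cw)
        qed
        moreover have "f w \<in> vec.span W \<longleftrightarrow> w \<in> vec.span W"
          by (rule lin_iso_span_iff[OF f(1)]) (use fU f(2) in \<open>auto simp: U_def\<close>)
        ultimately have fw: "f w \<in> vec.span W" by blast
        have ij: "i \<notin> W" "j \<notin> W" using p0 pl by (auto simp: W_def)
        have "W \<subseteq> E" using BE by (auto simp: W_def)
        then have fw0: "coord (f w) i = 0" "coord (f w) j = 0" using fw ij by (auto simp: span_iff)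
        have "x = w + coord x i *s i + coord x j *s j" by (simp add: w_def)
        then have "f x = f w + (coord x i * a) *s i + (coord x j * a) *s j"
          using a b \<open>a = b\<close> by (metis vec.linear_add[OF lf] vec.linear_scale[OF lf] vec.scale_scale)
        then have fx: "coord (f x) i = coord x i * a" "coord (f x) j = coord x j * a"
          using fw0 iE \<open>i \<noteq> j\<close> by (auto simp: coord_add coord_scale coord_basis)
        obtain c where "c \<noteq> 0" "f x = c *s y" using f(3) by (auto simp: par_def)
        then have "c * coord y i = coord x i * a" "c * coord y j = coord x j * a"
          using fx by (simp_all add: coord_scale)
        then have "\<rho> i = a / c" "\<rho> j = a / c"
          using i j \<open>c \<noteq> 0\<close> by (simp_all add: \<rho>_def field_simps)
        then show False using ne by simp
      next
        assume F: "\<forall>a::'a. a = 0 \<or> a = 1 \<or> a = -1"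
        \<comment> \<open>Here \<open>U\<close> alone suffices: its span contains both or neither of
          \<open>x\<close> and \<open>y\<close>, which \<open>ternary_sum_eq_0\<close> excludes when
          the ratios at the two ends differ.\<close>
        have "card U < r" using cU cB r by linarith
        then obtain f where f: "lin_iso f" "\<And>u. u \<in> U \<Longrightarrow> par (f u) u" "par (f x) y"
          using hyp[OF UZ fU] by auto
        have mid': "coord y (p q) = 0" if "0 < q" "q < l" for q using mid[OF that] supp by simp
        have "x \<in> vec.span U \<longleftrightarrow> y \<in> vec.span U"
          using lin_iso_span_iff[OF f(1) fU f(2), of x] f(3) par_in_span par_sym by blast
        then have eq: "g 0 * coord x i + g l * coord x j = 0 \<longleftrightarrow> g 0 * coord y i + g l * coord y j = 0"
          using gU[of x] gU[of y] x0 y0 ends[of x, OF mid] ends[of y, OF mid'] by simp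
        have y\<rho>: "coord y i = coord x i * \<rho> i" "coord y j = coord x j * \<rho> j"
          using i j by (simp_all add: \<rho>_def)
        have "\<rho> i \<noteq> 0" "\<rho> j \<noteq> 0" using i j supp by (auto simp: \<rho>_def)
        then have "\<not> (g 0 * coord x i + g l * coord x j = 0 \<longleftrightarrow>
            (g 0 * coord x i) * \<rho> i + (g l * coord x j) * \<rho> j = 0)"
          using i j gnz[of 0] gnz[of l] ne by (intro ternary_sum_eq_0[OF F]) auto
        then show False using eq by (simp add: y\<rho> mult.assoc)
      qed
    qed

    \<comment> \<open>The diagonal map taking \<open>x\<close> to \<open>y\<close>\<close>
    have symR: "sym (R\<^sup>*)" by (rule sym_rtrancl) (auto simp: R_def sym_def)
    define C where "C b = {b'. coord x b' \<noteq> 0 \<and> (b, b') \<in> R\<^sup>*}" for b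
    \<comment> \<open>The entry is the common ratio on the component of \<open>b\<close>. Components
      that miss the support of \<open>x\<close> get the default 1, which keeps the map
      invertible.\<close>
    define t where "t b = (if C b = {} then 1 else \<rho> (SOME b'. b' \<in> C b))" for b
    have tC: "t b = \<rho> b'" if "b' \<in> C b" for b b'
    proof -
      have "(SOME b'. b' \<in> C b) \<in> C b" using that by (rule someI)
      then obtain b'' where b'': "b'' = (SOME b'. b' \<in> C b)" "coord x b'' \<noteq> 0" "(b, b'') \<in> R\<^sup>*"
        unfolding C_def by blast
      have "coord x b' \<noteq> 0" "(b, b') \<in> R\<^sup>*" using that by (simp_all add: C_def)
      then have "\<rho> b'' = \<rho> b'"
        using consistent[OF b''(2)] rtrancl_trans[OF symD[OF symR b''(3)]] by blast
      moreover have "C b \<noteq> {}" using that by blast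
      ultimately show ?thesis using b''(1) by (simp add: t_def)
    qed
    have t0: "t b \<noteq> 0" for b
    proof (cases "C b = {}")
      case False
      then obtain b' where "b' \<in> C b" by blast
      then show ?thesis using tC[of b' b] supp by (auto simp: C_def \<rho>_def)
    qed (simp add: t_def)
    have tR: "t b = t b'" if "(b, b') \<in> R" for b b'
    proof -
      have "(b', b) \<in> R" using that by (auto simp: R_def)
      then have "C b = C b'" using that unfolding C_def by (auto intro: converse_rtrancl_into_rtrancl)
      then show ?thesis by (simp add: t_def)
    qed
    have "lin_iso (diag t)" by (rule lin_iso_diag) (rule t0)
    moreover have "par (diag t z) z" if z: "z \<in> Z" for z
    proof (cases "\<exists>b. coord z b \<noteq> 0")
      case True
      then obtain b where b: "coord z b \<noteq> 0" by blast
      have "diag t z = t b *s z"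
      proof (rule diag_eigen)
        fix b' assume "coord z b' \<noteq> 0"
        then have "(b, b') \<in> R" using b z Z0 by (auto simp: R_def)
        then show "t b' = t b" using tR by simp
      qed
      then show ?thesis using t0 by (auto simp: par_def)
    next
      case False
      then have "diag t z = 1 *s z" by (intro diag_eigen) auto
      then show ?thesis by simp
    qed
    moreover have "diag t x = y"
    proof (rule coord_eqI)
      fix b assume "b \<in> E"
      show "coord (diag t x) b = coord y b"
        using tC[of b b] supp[of b] by (cases "coord x b = 0") (auto simp: coord_diag C_def \<rho>_def)
    qed
    ultimately show ?thesis by (intro exI[of _ "diag t"]) auto
  qed
qed

text \<open>Points are added one at a time. Once \<open>f\<close> has carried the earlier points to
  their targets, the next one is moved by a map fixing these targets. Maps for subtuples become maps
  of that kind on composition with the inverse of \<open>f\<close>.\<close>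

lemma tuple_par:
  fixes x y :: "'i \<Rightarrow> 'a::field^'n"
  assumes fin: "finite S" and r: "CARD('n) \<le> r"
    and small: "CARD('n) + 2 \<le> r \<or> (\<forall>a::'a. a = 0 \<or> a = 1 \<or> a = -1)"
    and hyp: "\<And>I. I \<subseteq> S \<Longrightarrow> card I \<le> r \<Longrightarrow> \<exists>f. lin_iso f \<and> (\<forall>i\<in>I. par (f (x i)) (y i))"
  shows "\<exists>f. lin_iso f \<and> (\<forall>i\<in>S. par (f (x i)) (y i))"
  using fin hyp
proof (induction S rule: finite_induct)
  case empty
  from empty(1)[of "{}"] show ?case by auto
next
  case (insert s S)
  have "\<exists>f. lin_iso f \<and> (\<forall>i\<in>S. par (f (x i)) (y i))"
    by (rule insert.IH) (rule insert.prems; auto)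
  then obtain f where f: "lin_iso f" "\<And>i. i \<in> S \<Longrightarrow> par (f (x i)) (y i)" by blast
  obtain g where g: "lin_iso g" "\<And>v. g (f v) = v" using f(1) by (metis lin_iso_inverse)
  have "\<exists>h. lin_iso h \<and> (\<forall>u\<in>y ` S. par (h u) u) \<and> par (h (f (x s))) (y s)"
  proof (rule extend_par[OF r small])
    fix I assume "I \<subseteq> y ` S" "finite I" and c: "card I < r"
    \<comment> \<open>Several indices may carry the same vector; choosing one for each keeps the
      count.\<close>
    then obtain J where J: "J \<subseteq> S" "inj_on y J" "I = y ` J" by (metis subset_image_inj)
    have "card J = card I" using J card_image by metis
    have "card (insert s J) \<le> Suc (card J)" 
      using finite_subset[OF J(1) insert.hyps(1)] by (simp add: card_insert_if)
    then have "card (insert s J) \<le> r" using c \<open>card J = card I\<close> by linarith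
    then obtain h where h: "lin_iso h" "\<And>i. i \<in> insert s J \<Longrightarrow> par (h (x i)) (y i)"
      using insert.prems[of "insert s J"] J by blast
    have "par (h (g (y j))) (y j)" if "j \<in> J" for j
    proof -
      have "par (y j) (f (x j))" using f(2) that J by (blast intro: par_sym)
      then have "par (h (g (y j))) (h (g (f (x j))))"
        by (rule lin_iso_par[OF h(1) lin_iso_par[OF g(1)]])
      then show ?thesis using h(2)[of j] that g by (auto intro: par_trans)
    qed
    then show "\<exists>h. lin_iso h \<and> (\<forall>u\<in>I. par (h u) u) \<and> par (h (f (x s))) (y s)"
      using h g by (intro exI[of _ "\<lambda>v. h (g v)"]) (auto intro: lin_iso_comp simp: J)
  qed
  then obtain h where h: "lin_iso h" "\<And>i. i \<in> S \<Longrightarrow> par (h (y i)) (y i)" "par (h (f (x s))) (y s)"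
    by blast
  have "par (h (f (x i))) (y i)" if "i \<in> S" for i
    using lin_iso_par[OF h(1) f(2)[OF that]] h(2)[OF that] by (rule par_trans)
  with h f(1) show ?case by (intro exI[of _ "\<lambda>v. h (f v)"]) (auto intro: lin_iso_comp)
qed

section \<open>Few points determine a pointwise stabilizer\<close>

text \<open>Greedy selection: a \<open>K z\<close> that does not contain the current subspace lowers
  its dimension by at least one, so the number of selected members is at most the total
  drop.\<close>

lemma subspace_chain:
  fixes K :: "'z \<Rightarrow> ('a::field^'n) set"
  assumes "vec.subspace S" and K: "\<And>z. z \<in> Z \<Longrightarrow> vec.subspace (K z)"
  shows "\<exists>J\<subseteq>Z. finite J \<and> S \<inter> (\<Inter>z\<in>J. K z) = S \<inter> (\<Inter>z\<in>Z. K z) \<and>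
    card J + vec.dim (S \<inter> (\<Inter>z\<in>Z. K z)) \<le> vec.dim S"
  using assms(1)
proof (induction "vec.dim S" arbitrary: S rule: less_induct)
  case less
  show ?case
  proof (cases "\<forall>z\<in>Z. S \<subseteq> K z")
    case True
    then have "S \<inter> (\<Inter>z\<in>Z. K z) = S" by blast
    then show ?thesis by (intro exI[of _ "{}"]) auto
  next
    case False
    then obtain z where z: "z \<in> Z" "\<not> S \<subseteq> K z" by blast
    have sub: "vec.subspace (S \<inter> K z)" using less.prems K z by (auto intro: vec.subspace_inter)
    have lt: "vec.dim (S \<inter> K z) < vec.dim S"
      using z sub less.prems by (intro vec.dim_psubset) (auto simp: vec.span_eq_iff[THEN iffD2])
    have eq: "S \<inter> K z \<inter> (\<Inter>z\<in>Z. K z) = S \<inter> (\<Inter>z\<in>Z. K z)" using z by blast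
    obtain J where J: "J \<subseteq> Z" "finite J"
      "S \<inter> K z \<inter> (\<Inter>z\<in>J. K z) = S \<inter> K z \<inter> (\<Inter>z\<in>Z. K z)"
      "card J + vec.dim (S \<inter> (\<Inter>z\<in>Z. K z)) \<le> vec.dim (S \<inter> K z)"
      using less.hyps[OF lt sub] eq by auto
    have "card (insert z J) \<le> Suc (card J)" using J by (simp add: card_insert_if)
    then show ?thesis using J eq lt z
      by (intro exI[of _ "insert z J"]) (auto simp: Int_assoc)
  qed
qed

context vec_basis
begin

text \<open>
  A diagonal map is encoded by the vector \<open>\<tau>\<close> of its entries, so that stabilizers become
  subspaces and their chains are bounded by dimension.
\<close>

definition const_on_supp :: "'a^'n \<Rightarrow> ('a^'n) set" where
  "const_on_supp z = {\<tau>. \<forall>b b'. coord z b \<noteq> 0 \<longrightarrow> coord z b' \<noteq> 0 \<longrightarrow> coord \<tau> b = coord \<tau> b'}"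

lemma const_on_suppI:
  "(\<And>b b'. coord z b \<noteq> 0 \<Longrightarrow> coord z b' \<noteq> 0 \<Longrightarrow> coord \<tau> b = coord \<tau> b') \<Longrightarrow> \<tau> \<in> const_on_supp z"
  unfolding const_on_supp_def by blast

lemma const_on_suppD:
  "\<tau> \<in> const_on_supp z \<Longrightarrow> coord z b \<noteq> 0 \<Longrightarrow> coord z b' \<noteq> 0 \<Longrightarrow> coord \<tau> b = coord \<tau> b'"
  unfolding const_on_supp_def by blast

lemma subspace_const_on_supp: "vec.subspace (const_on_supp z)"
proof (rule vec.subspaceI)
  show "0 \<in> const_on_supp z" by (rule const_on_suppI) simp
next
  fix u v assume "u \<in> const_on_supp z" "v \<in> const_on_supp z"
  then show "u + v \<in> const_on_supp z"
    by (intro const_on_suppI) (simp only: coord_add, metis const_on_suppD)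
next
  fix c u assume "u \<in> const_on_supp z"
  then show "c *s u \<in> const_on_supp z"
    by (intro const_on_suppI) (simp only: coord_scale, metis const_on_suppD)
qed

text \<open>On \<open>Z\<close> the map agrees with \<open>diag t\<close>, where \<open>t\<close>
  lists its eigenvalues on \<open>B\<close>, and a vector of \<open>Z\<close> is an eigenvector
  exactly when \<open>t\<close> is constant on its support. The points of \<open>J\<close> impose
  this condition on \<tau>, and \<open>C\<close> passes it on to all of \<open>Z\<close>.\<close>

lemma eigen_from_basis:
  assumes B: "B \<subseteq> E" "Z \<subseteq> vec.span B" and J: "J \<subseteq> Z"
    and C: "vec.span B \<inter> (\<Inter>z\<in>J. const_on_supp z) \<subseteq> (\<Inter>z\<in>Z. const_on_supp z)"
    and f: "lin f" "\<And>u. u \<in> B \<union> J \<Longrightarrow> \<exists>c. f u = c *s u" and z: "z \<in> Z"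
  shows "\<exists>c. f z = c *s z"
proof -
  obtain t where t: "\<And>b. b \<in> B \<Longrightarrow> f b = t b *s b" using f(2) by (metis UnI1)
  have Z0: "coord z b = 0" if "z \<in> Z" "b \<notin> B" for z b using that B by (auto simp: span_iff)
  have fz: "f z = diag t z" if "z \<in> Z" for z
  proof -
    have "f z = (\<Sum>b\<in>E. coord z b *s f b)"
      by (subst sum_coord[of z, symmetric]) (simp add: vec.linear_sum[OF f(1)] vec.linear_scale[OF f(1)])
    also have "\<dots> = diag t z"
      unfolding diag_def
    proof (rule sum.cong)
      fix b show "coord z b *s f b = (t b * coord z b) *s b"
        using Z0[OF that, of b] t by (cases "b \<in> B") (auto simp: mult.commute)
    qed simp
    finally show ?thesis .
  qed
  define \<tau> where "\<tau> = (\<Sum>b\<in>B. t b *s b)"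
  have c\<tau>: "coord \<tau> b = t b" if "b \<in> B" for b using that B by (simp add: \<tau>_def coord_sum_basis)
  have "\<tau> \<in> vec.span B" unfolding \<tau>_def by (intro vec.span_sum vec.span_scale vec.span_base)
  moreover have "\<tau> \<in> const_on_supp j" if "j \<in> J" for j
  proof -
    obtain c where c: "f j = c *s j" using f(2) \<open>j \<in> J\<close> by blast
    have "j \<in> Z" using that J by blast
    have "t b = c" if "coord j b \<noteq> 0" for b
    proof -
      have "t b * coord j b = c * coord j b"
        using c fz[OF \<open>j \<in> Z\<close>] by (metis coord_diag coord_scale)
      then show ?thesis using that by simp
    qed
    then show ?thesis using c\<tau> Z0[OF \<open>j \<in> Z\<close>] by (intro const_on_suppI) metis
  qed
  ultimately have "\<tau> \<in> const_on_supp z" using C z by blast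
  then have "t b = t b'" if "coord z b \<noteq> 0" "coord z b' \<noteq> 0" for b b'
    using const_on_suppD[of \<tau> z b b'] that c\<tau> Z0[OF z] by metis
  then obtain c where "\<And>b. coord z b \<noteq> 0 \<Longrightarrow> t b = c" by metis
  then have "diag t z = c *s z" by (intro diag_eigen)
  then show ?thesis using fz[OF z] by auto
qed

text \<open>The space \<open>T\<close>, which imposes equality only at \<open>p\<close> and
  \<open>q\<close>, lies strictly in between: it contains \<open>p + q\<close>, which is not in
  \<open>S\<close>, and it does not contain \<open>p\<close>.\<close>

lemma dim_two_less:
  assumes B: "B \<subseteq> E" and S: "vec.subspace S" "S \<subseteq> vec.span B"
    and pqr: "p \<in> B" "q \<in> B" "r \<in> B" "p \<noteq> q" "q \<noteq> r" "p \<noteq> r"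
    and eq: "\<And>\<tau>. \<tau> \<in> S \<Longrightarrow> coord \<tau> p = coord \<tau> q \<and> coord \<tau> q = coord \<tau> r"
  shows "vec.dim S + 2 \<le> card B"
proof -
  define T where "T = vec.span B \<inter> {\<tau>. coord \<tau> p = coord \<tau> q}"
  have sT: "vec.subspace T" unfolding T_def
    by (intro vec.subspace_inter vec.subspace_span vec.subspaceI) (auto simp: coord_add coord_scale)
  have E: "p \<in> E" "q \<in> E" "r \<in> E" using pqr B by auto
  have "S \<subseteq> T" using S eq by (auto simp: T_def)
  moreover have "p + q \<in> T" using pqr E by (auto simp: T_def coord_add coord_basis intro: vec.span_add vec.span_base)
  moreover have "p + q \<notin> S" using eq[of "p + q"] pqr E by (auto simp: coord_add coord_basis)
  ultimately have "vec.span S \<subset> vec.span T" using S sT by (auto simp: vec.span_eq_iff[THEN iffD2])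
  then have 1: "vec.dim S < vec.dim T" by (rule vec.dim_psubset)
  have "T \<subseteq> vec.span B" by (auto simp: T_def)
  moreover have "p \<in> vec.span B" using pqr by (simp add: vec.span_base)
  moreover have "p \<notin> T" using pqr E by (auto simp: T_def coord_basis)
  ultimately have "vec.span T \<subset> vec.span (vec.span B)" using sT by (auto simp: vec.span_eq_iff[THEN iffD2] vec.span_span)
  then have 2: "vec.dim T < vec.dim (vec.span B)" by (rule vec.dim_psubset)
  have "vec.independent B" using indep B by (rule vec.independent_mono)
  then have "vec.dim (vec.span B) = card B" by (rule vec.dim_span_eq_card_independent)
  with 1 2 show ?thesis by linarith
qed

text \<open>As \<open>q\<close> is a combination of the eigenvectors \<open>p\<close> and
  \<open>z\<close>, its image stays in the plane spanned by \<open>p\<close> and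
  \<open>q\<close>.\<close>

lemma eigen_two_supp:
  assumes f: "lin f" "f p = a *s p" "f z = c *s z" and E: "p \<in> E" "q \<in> E" "p \<noteq> q"
    and z: "coord z q \<noteq> 0" "\<And>e. e \<noteq> p \<Longrightarrow> e \<noteq> q \<Longrightarrow> coord z e = 0" and e: "e \<noteq> p" "e \<noteq> q"
  shows "coord (f q) e = 0"
proof -
  have "z = coord z p *s p + coord z q *s q"
    by (rule coord_eqI) (use z E in \<open>auto simp: coord_add coord_scale coord_basis\<close>)
  then have "f z = coord z p *s (a *s p) + coord z q *s f q"
    using f by (metis vec.linear_add vec.linear_scale)
  then have "coord (f z) e = coord z q * coord (f q) e"
    using e E by (simp add: coord_add coord_scale coord_basis)
  then show ?thesis using f(3) z e by (simp add: coord_scale)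
qed

end

text \<open>
  A basis \<open>B \<subseteq> Z\<close> together with one point for each drop in dimension gives \<open>2n - 1\<close> points at most.
  One point is saved if the stabilizer is not scalar or if some point involves three basis vectors,
  since it lowers the dimension by two. Otherwise there are points on the lines through \<open>p, q\<close> and
  through \<open>q, r\<close> for some \<open>p, q, r \<in> B\<close>, and \<open>q\<close>, the intersection of these lines, can be left out.
\<close>

lemma few_determine_eigenvectors:
  fixes Z :: "('a::field^'n) set"
  assumes n: "CARD('n) \<ge> 3"
  obtains I where "I \<subseteq> Z" "finite I" "card I \<le> 2 * CARD('n) - 2"
    "\<And>f z. lin f \<Longrightarrow> (\<And>u. u \<in> I \<Longrightarrow> \<exists>c. f u = c *s u) \<Longrightarrow> z \<in> Z \<Longrightarrow> \<exists>c. f z = c *s z"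
proof -
  obtain B where BZ: "B \<subseteq> Z" and Bi: "vec.independent B" and ZB: "Z \<subseteq> vec.span B"
    by (rule vec.maximal_independent_subset)
  obtain E where "vec_basis E" and BE: "B \<subseteq> E" using Bi by (rule vec_basis_extend)
  interpret vec_basis E by fact
  have card_E: "card E = CARD('n)" by (rule vec_basis_card) fact
  have fB: "finite B" using BE by (rule finite_subset) simp
  have cB: "card B \<le> CARD('n)" using card_mono[OF _ BE] card_E by simp
  have dB: "vec.dim (vec.span B) = card B" using Bi by (rule vec.dim_span_eq_card_independent)
  have Z0: "coord z b = 0" if "z \<in> Z" "b \<notin> B" for z b using that ZB BE by (auto simp: span_iff)
  note subK = subspace_const_on_supp
  define C where "C = vec.span B \<inter> (\<Inter>z\<in>Z. const_on_supp z)"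
  \<comment> \<open>This vector encodes the identity map, so it satisfies the conditions of all
    points, and \<open>C\<close> has positive dimension when \<open>B\<close> is nonempty.\<close>
  define \<sigma> where "\<sigma> = (\<Sum>b\<in>B. 1 *s b)"
  have c\<sigma>: "coord \<sigma> b = (if b \<in> B then 1 else 0)" for b
    unfolding \<sigma>_def using coord_sum_basis[OF BE, of "\<lambda>_. 1" b] by simp
  have "\<sigma> \<in> vec.span B" unfolding \<sigma>_def by (intro vec.span_sum vec.span_scale vec.span_base)
  moreover have "\<sigma> \<in> const_on_supp z" if "z \<in> Z" for z
    using Z0[OF that] by (intro const_on_suppI) (auto simp: c\<sigma>)
  ultimately have \<sigma>C: "\<sigma> \<in> C" by (auto simp: C_def)
  obtain J where J: "J \<subseteq> Z" "finite J" "vec.span B \<inter> (\<Inter>z\<in>J. const_on_supp z) = C"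
    "card J + vec.dim C \<le> card B"
    using subspace_chain[of "vec.span B" Z const_on_supp, OF vec.subspace_span subK] dB
    unfolding C_def[symmetric] by auto
  have le: "card (B \<union> J) \<le> card B + card J" by (rule card_Un_le)
  show thesis
  proof (cases "card B < CARD('n) \<or> vec.dim C \<ge> 2")
    case True
    then have "card (B \<union> J) \<le> 2 * CARD('n) - 2" using le J(4) cB by linarith
    moreover have "vec.span B \<inter> (\<Inter>z\<in>J. const_on_supp z) \<subseteq> (\<Inter>z\<in>Z. const_on_supp z)"
      using J(3) by (auto simp: C_def)
    ultimately show thesis
      using that[of "B \<union> J"] BZ J fB eigen_from_basis[OF BE ZB J(1)] by blast
  next
    case False
    then have cBn: "card B = CARD('n)" and dC: "vec.dim C < 2" using cB by auto
    have "B \<noteq> {}" using cBn n by auto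
    then have "\<sigma> \<noteq> 0" using c\<sigma> coord_0 by (metis ex_in_conv one_neq_zero)
    then have "vec.dim C \<noteq> 0" using \<sigma>C vec.dim_eq_0 by blast
    then have dC1: "1 \<le> vec.dim C" by linarith
    \<comment> \<open>From a subspace of codimension at least two, the chain down to
      \<open>C\<close>, which has dimension at least one, takes at most \<open>CARD('n) - 3\<close>
      further points.\<close>
    have rest: "\<exists>J'\<subseteq>Z. finite J' \<and> card J' + 3 \<le> CARD('n) \<and> S \<inter> (\<Inter>z\<in>J'. const_on_supp z) = C"
      if S: "vec.subspace S" "S \<subseteq> vec.span B" "C \<subseteq> S"
        and pqr: "p \<in> B" "q \<in> B" "r \<in> B" "p \<noteq> q" "q \<noteq> r" "p \<noteq> r"
        and eq: "\<And>\<tau>. \<tau> \<in> S \<Longrightarrow> coord \<tau> p = coord \<tau> q \<and> coord \<tau> q = coord \<tau> r" for S p q r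
    proof -
      have "vec.dim S + 2 \<le> card B" using dim_two_less[OF BE S(1,2) pqr eq] .
      moreover have "S \<inter> (\<Inter>z\<in>Z. const_on_supp z) = C" using S by (auto simp: C_def)
      moreover obtain J' where "J' \<subseteq> Z" "finite J'"
        "S \<inter> (\<Inter>z\<in>J'. const_on_supp z) = S \<inter> (\<Inter>z\<in>Z. const_on_supp z)"
        "card J' + vec.dim (S \<inter> (\<Inter>z\<in>Z. const_on_supp z)) \<le> vec.dim S"
        using subspace_chain[of S Z const_on_supp, OF S(1) subK] by blast
      ultimately show ?thesis
        using dC1 cBn by (intro exI[of _ J']) simp
    qed
    show thesis
    proof (cases "\<exists>z\<in>Z. \<exists>p q r. p \<noteq> q \<and> q \<noteq> r \<and> p \<noteq> r \<and> coord z p \<noteq> 0 \<and> coord z q \<noteq> 0 \<and> coord z r \<noteq> 0")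
      case True
      then obtain z p q r where z: "z \<in> Z" "p \<noteq> q" "q \<noteq> r" "p \<noteq> r"
        "coord z p \<noteq> 0" "coord z q \<noteq> 0" "coord z r \<noteq> 0" by blast
      have pqr: "p \<in> B" "q \<in> B" "r \<in> B" using z Z0 by auto
      let ?S = "vec.span B \<inter> const_on_supp z"
      obtain J' where J': "J' \<subseteq> Z" "finite J'" "card J' + 3 \<le> CARD('n)" "?S \<inter> (\<Inter>z\<in>J'. const_on_supp z) = C"
      proof -
        have "C \<subseteq> ?S" using z by (auto simp: C_def)
        moreover have "coord \<tau> p = coord \<tau> q \<and> coord \<tau> q = coord \<tau> r" if "\<tau> \<in> ?S" for \<tau>
          using that z by (blast intro: const_on_suppD)
        ultimately show thesis
          using rest[OF vec.subspace_inter[OF vec.subspace_span subK] Int_lower1 _ pqr z(2-4)] that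
          by blast
      qed
      let ?J = "insert z J'"
      have JZ: "?J \<subseteq> Z" using J' z by blast
      have "card (B \<union> ?J) \<le> card B + card ?J" by (rule card_Un_le)
      also have "card ?J \<le> Suc (card J')" using J' by (simp add: card_insert_if)
      finally have "card (B \<union> ?J) \<le> 2 * CARD('n) - 2" using J' cB by linarith
      moreover have "vec.span B \<inter> (\<Inter>z\<in>?J. const_on_supp z) \<subseteq> (\<Inter>z\<in>Z. const_on_supp z)"
        using J'(4) by (auto simp: C_def)
      ultimately show thesis
        using that[of "B \<union> ?J"] BZ J' fB eigen_from_basis[OF BE ZB JZ] JZ by blast
    next
      case no3: False
      \<comment> \<open>Otherwise two supports with at least two elements would be equal or
        disjoint. Then the sum \<open>p + q\<close> over such a support, or any single basis vector
        if there is none, would lie in \<open>C\<close> and be independent of \<sigma>.\<close>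
      have "\<exists>z\<in>Z. \<exists>z'\<in>Z. \<exists>p q r. p \<noteq> q \<and> q \<noteq> r \<and> p \<noteq> r \<and>
          coord z p \<noteq> 0 \<and> coord z q \<noteq> 0 \<and> coord z' q \<noteq> 0 \<and> coord z' r \<noteq> 0"
      proof (rule ccontr)
        assume no: "\<not> ?thesis"
        obtain \<tau> where \<tau>: "\<tau> \<in> vec.span B" "\<tau> \<noteq> 0" "\<exists>b\<in>B. coord \<tau> b = 0"
          "\<And>z. z \<in> Z \<Longrightarrow> \<tau> \<in> const_on_supp z"
        proof (cases "\<exists>z\<in>Z. \<exists>p q. p \<noteq> q \<and> coord z p \<noteq> 0 \<and> coord z q \<noteq> 0")
          case True
          then obtain z p q where z: "z \<in> Z" "p \<noteq> q" "coord z p \<noteq> 0" "coord z q \<noteq> 0" by blast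
          then have pq: "p \<in> B" "q \<in> B" using Z0 by auto
          then have E: "p \<in> E" "q \<in> E" using BE by auto
          have cpq: "coord (p + q) b = (if b = p \<or> b = q then 1 else 0)" for b
            using E z by (auto simp: coord_add coord_basis)
          have "card {p, q} < card B" using cBn n z by simp
          then have "\<not> B \<subseteq> {p, q}" using card_mono[of "{p, q}" B] by auto
          then obtain b where b: "b \<in> B" "b \<noteq> p" "b \<noteq> q" by blast
          show thesis
          proof (rule that[of "p + q"])
            show "p + q \<in> vec.span B" using pq by (intro vec.span_add vec.span_base)
            show "p + q \<noteq> 0" using cpq[of p] by auto
            show "\<exists>b\<in>B. coord (p + q) b = 0" using b cpq by auto
            fix z' assume z': "z' \<in> Z"
            show "p + q \<in> const_on_supp z'"
            proof (rule const_on_suppI)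
              fix c c' assume "coord z' c \<noteq> 0" "coord z' c' \<noteq> 0"
              then have "c = p \<or> c = q \<longleftrightarrow> c' = p \<or> c' = q"
                using no z z' by metis
              then show "coord (p + q) c = coord (p + q) c'" by (simp only: cpq)
            qed
          qed
        next
          case False
          obtain p where p: "p \<in> B" using \<open>B \<noteq> {}\<close> by blast
          have "card {p} < card B" using cBn n by simp
          then have "\<not> B \<subseteq> {p}" using card_mono[of "{p}" B] by auto
          then obtain b where b: "b \<in> B" "b \<noteq> p" by blast
          show thesis
          proof (rule that[of p])
            show "p \<in> vec.span B" using p by (rule vec.span_base)
            show "p \<noteq> 0" using Bi p vec.dependent_zero by blast
            show "\<exists>b\<in>B. coord p b = 0"
              using b coord_basis[of p b] p BE by (intro bexI[of _ b]) auto
            show "p \<in> const_on_supp z" if "z \<in> Z" for z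
              using that False by (intro const_on_suppI) metis
          qed
        qed
        have "\<sigma> \<notin> vec.span {\<tau>}"
        proof
          assume "\<sigma> \<in> vec.span {\<tau>}"
          then obtain k where k: "\<sigma> = k *s \<tau>" by (auto simp: vec.span_singleton)
          obtain b where "b \<in> B" "coord \<tau> b = 0" using \<tau> by blast
          then show False using c\<sigma>[of b] by (simp add: k coord_scale)
        qed
        moreover have "vec.independent {\<tau>}" using \<tau>(2) by simp
        ultimately have ind: "vec.independent {\<sigma>, \<tau>}" by (rule vec.independent_insertI)
        have "\<sigma> \<noteq> \<tau>" using \<open>\<sigma> \<notin> vec.span {\<tau>}\<close> by (auto intro: vec.span_base)
        moreover have "{\<sigma>, \<tau>} \<subseteq> C" using \<sigma>C \<tau> by (auto simp: C_def)
        ultimately have "2 \<le> vec.dim C" using vec.independent_card_le_dim[OF _ ind] by force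
        then show False using dC by simp
      qed
      then obtain z z' p q r where z: "z \<in> Z" "z' \<in> Z" "p \<noteq> q" "q \<noteq> r" "p \<noteq> r"
        "coord z p \<noteq> 0" "coord z q \<noteq> 0" "coord z' q \<noteq> 0" "coord z' r \<noteq> 0" by blast
      have pqr: "p \<in> B" "q \<in> B" "r \<in> B" using z Z0 by auto
      then have E: "p \<in> E" "q \<in> E" "r \<in> E" using BE by auto
      let ?S = "vec.span B \<inter> (const_on_supp z \<inter> const_on_supp z')"
      obtain J' where J': "J' \<subseteq> Z" "finite J'" "card J' + 3 \<le> CARD('n)" "?S \<inter> (\<Inter>z\<in>J'. const_on_supp z) = C"
      proof -
        have "C \<subseteq> ?S" using z by (auto simp: C_def)
        moreover have "coord \<tau> p = coord \<tau> q \<and> coord \<tau> q = coord \<tau> r" if "\<tau> \<in> ?S" for \<tau>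
          using that z by (blast intro: const_on_suppD)
        ultimately show thesis
          using rest[OF vec.subspace_inter[OF vec.subspace_span vec.subspace_inter[OF subK subK]]
              Int_lower1 _ pqr z(3-5)] that
          by blast
      qed
      \<comment> \<open>The point \<open>q\<close> is traded for \<open>z\<close> and
        \<open>z'\<close>: the count is \<open>CARD('n) - 1\<close>, plus 2, plus at most
        \<open>CARD('n) - 3\<close>.\<close>
      let ?J = "insert z (insert z' J')" and ?I = "(B - {q}) \<union> insert z (insert z' J')"
      have JZ: "?J \<subseteq> Z" using J' z by blast
      have "card ?I \<le> card (B - {q}) + card ?J" by (rule card_Un_le)
      also have "card (B - {q}) = card B - 1" using pqr by simp
      also have "card ?J \<le> Suc (Suc (card J'))" using J' by (simp add: card_insert_if)
      finally have cI: "card ?I \<le> 2 * CARD('n) - 2" using J' cBn n by linarith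
      have sub: "vec.span B \<inter> (\<Inter>z\<in>?J. const_on_supp z) \<subseteq> (\<Inter>z\<in>Z. const_on_supp z)"
        using J'(4) by (auto simp: C_def)
      show thesis
      proof (rule that[of ?I])
        show "?I \<subseteq> Z" "finite ?I" using JZ BZ J' fB by auto
        show "card ?I \<le> 2 * CARD('n) - 2" by (rule cI)
        fix f y assume f: "lin f" and eig: "\<And>u. u \<in> ?I \<Longrightarrow> \<exists>c. f u = c *s u" and y: "y \<in> Z"
        obtain a c where 1: "f p = a *s p" "f z = c *s z" using eig[of p] eig[of z] pqr z by auto
        obtain a' c' where 2: "f r = a' *s r" "f z' = c' *s z'" using eig[of r] eig[of z'] pqr z by auto
        have "coord z e = 0" if "e \<noteq> p" "e \<noteq> q" for e using no3 z that by blast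
        then have 3: "coord (f q) e = 0" if "e \<noteq> p" "e \<noteq> q" for e
          using eigen_two_supp[OF f 1] E z that by blast
        have "coord z' e = 0" if "e \<noteq> r" "e \<noteq> q" for e using no3 z that by blast
        then have 4: "coord (f q) e = 0" if "e \<noteq> r" "e \<noteq> q" for e
          using eigen_two_supp[OF f 2] E z that by blast
        \<comment> \<open>The image lies in the plane of \<open>p, q\<close> and in that of
          \<open>q, r\<close>, hence on the line through \<open>q\<close>.\<close>
        have "f q = coord (f q) q *s q"
        proof (rule coord_eqI)
          fix e show "coord (f q) e = coord (coord (f q) q *s q) e"
            using 3[of e] 4[of e] z E by (auto simp: coord_scale coord_basis)
        qed
        then have "\<exists>c. f u = c *s u" if "u \<in> B \<union> ?J" for u
          using that eig by (cases "u = q") auto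
        then show "\<exists>c. f y = c *s y" by (rule eigen_from_basis[OF BE ZB JZ sub f _ y])
      qed
    qed
  qed
qed

section \<open>Relational complexity in terms of matrices\<close>

lemma lin_vector_matrix: "lin (\<lambda>v. v v* (A :: 'a::field^'n^'n))"
  by (rule lin_I) (simp_all add: vector_matrix_left_distrib scalar_vector_matrix_assoc)

lemma proj_points_iff:
  fixes W :: "('a::field^'n) set"
  shows "W \<in> proj_points \<longleftrightarrow> (\<exists>x. x \<noteq> 0 \<and> W = vec.span {x})"
proof
  assume W: "W \<in> proj_points"
  then have sub: "vec.subspace W" and dim: "vec.dim W = 1" by (auto simp: proj_points_def)
  obtain B where B: "B \<subseteq> W" "vec.independent B" "W \<subseteq> vec.span B" "card B = vec.dim W"
    by (rule vec.basis_exists)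
  then obtain x where x: "B = {x}" using dim card_1_singletonE by metis
  then have "x \<noteq> 0" using B(2) by simp
  moreover have "W = vec.span {x}" using B sub x vec.span_minimal[of "{x}" W] by blast
  ultimately show "\<exists>x. x \<noteq> 0 \<and> W = vec.span {x}" by blast
qed (auto simp: proj_points_def vec.subspace_span)

lemma span_singleton_eq_iff:
  fixes x y :: "'a::field^'n"
  assumes "y \<noteq> 0"
  shows "vec.span {x} = vec.span {y} \<longleftrightarrow> par x y"
proof
  assume eq: "vec.span {x} = vec.span {y}"
  then have "x \<in> vec.span {y}" "y \<in> vec.span {x}" using vec.span_base by blast+
  then obtain c d where c: "x = c *s y" and d: "y = d *s x" unfolding vec.span_singleton by blast
  have "c \<noteq> 0"
  proof
    assume "c = 0"
    then have "x = 0" using c by simp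
    then have "y = 0" using d by (simp only: vec.scale_zero_right)
    with assms show False by contradiction
  qed
  with c show "par x y" unfolding par_def by blast
next
  assume xy: "par x y"
  have "vec.span {x} \<subseteq> vec.span {y}" if "par x y" for x y :: "'a^'n"
    using that by (intro vec.span_minimal) (auto intro: par_in_span vec.span_base)
  then show "vec.span {x} = vec.span {y}" using xy par_sym[OF xy] by blast
qed

lemma proj_act_span:
  fixes A :: "'a::field^'n^'n"
  assumes "y \<noteq> 0"
  shows "proj_act (vec.span {x}) (scalar_matrices #>\<^bsub>GL\<^esub> A) = vec.span {y} \<longleftrightarrow> par (x v* A) y"
proof -
  have "proj_act (vec.span {x}) (scalar_matrices #>\<^bsub>GL\<^esub> A) = (\<lambda>v. v v* A) ` vec.span {x}"
    by (rule proj_act_coset) simp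
  also have "\<dots> = vec.span ((\<lambda>v. v v* A) ` {x})"
    using lin_vector_matrix by (rule vec.linear_span_image[symmetric])
  finally show ?thesis using span_singleton_eq_iff[OF assms] by simp
qed

text \<open>Replaces cosets by matrices, so that membership in the group can be read off from
  determinants.\<close>

definition lifts :: "('a::field^'n^'n) set set \<Rightarrow> ('a^'n^'n) set" where
  "lifts H = {A. invertible A \<and> scalar_matrices #>\<^bsub>GL\<^esub> A \<in> H}"

lemma carrier_PGL: "carrier PGL = {scalar_matrices #>\<^bsub>GL\<^esub> A | A. invertible A}"
  by (auto simp: PGL_def FactGroup_def RCOSETS_def GL_def)

lemma lifts_PGL: "lifts (carrier PGL) = {A :: 'a::field^'n^'n. invertible A}"
  by (auto simp: lifts_def carrier_PGL)

lemma ex_lift: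
  assumes "H \<subseteq> carrier PGL"
  shows "(\<exists>C\<in>H. P C) \<longleftrightarrow> (\<exists>A\<in>lifts H. P (scalar_matrices #>\<^bsub>GL\<^esub> A))"
  using assms unfolding lifts_def carrier_PGL by blast

text \<open>Points become spanning vectors. As \<open>r \<le> k\<close>, smaller index sets extend
  to sets of exactly \<open>r\<close> elements, so equivalence yields the bound
  \<open>card I \<le> r\<close>, which is inherited by subtuples.\<close>

lemma relational_complexity_le:
  fixes H :: "('a::field^'n^'n) set set"
  assumes H: "H \<subseteq> carrier PGL" and r: "1 \<le> r"
    and main: "\<And>k (x :: nat \<Rightarrow> 'a^'n) y.
      (\<And>I. I \<subseteq> {..<k} \<Longrightarrow> card I \<le> r \<Longrightarrow> \<exists>A\<in>lifts H. \<forall>i\<in>I. par (x i v* A) (y i)) \<Longrightarrow>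
      \<exists>A\<in>lifts H. \<forall>i<k. par (x i v* A) (y i)"
  shows "relational_complexity H proj_act proj_points \<le> enat r"
  unfolding relational_complexity_def
proof (rule Inf_lower, rule CollectI, rule exI[of _ r], intro conjI allI impI ballI)
  fix k and X Y :: "('a^'n) set list"
  assume k: "r \<le> k" and X: "X \<in> lists proj_points" and Y: "Y \<in> lists proj_points"
    and len: "length X = k" "length Y = k" and eq: "equivalent_under H proj_act r X Y"
  have "\<forall>i<k. \<exists>x. x \<noteq> 0 \<and> X ! i = vec.span {x}" "\<forall>i<k. \<exists>y. y \<noteq> 0 \<and> Y ! i = vec.span {y}"
    using X Y len by (auto simp: in_lists_conv_set proj_points_iff dest!: nth_mem)
  then obtain x y where x: "X ! i = vec.span {x i}" and y: "y i \<noteq> 0" "Y ! i = vec.span {y i}"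
    if "i < k" for i by metis
  have "\<exists>A\<in>lifts H. \<forall>i<k. par (x i v* A) (y i)"
  proof (rule main)
    fix I assume I: "I \<subseteq> {..<k}" "card I \<le> r"
    then obtain I' where I': "I \<subseteq> I'" "I' \<subseteq> {..<k}" "card I' = r"
      using exists_subset_between[of I r "{..<k}"] k by auto
    then have "\<exists>C\<in>H. \<forall>i\<in>I'. proj_act (X ! i) C = Y ! i"
      using eq len by (auto simp: equivalent_under_def)
    then obtain A where A: "A \<in> lifts H" "\<forall>i\<in>I'. proj_act (X ! i) (scalar_matrices #>\<^bsub>GL\<^esub> A) = Y ! i"
      unfolding ex_lift[OF H] by blast
    have "par (x i v* A) (y i)" if "i \<in> I" for i
    proof -
      have "i < k" "i \<in> I'" using that I I' by auto
      then show ?thesis using A(2) x y proj_act_span[of "y i" "x i" A] by metis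
    qed
    with A show "\<exists>A\<in>lifts H. \<forall>i\<in>I. par (x i v* A) (y i)" by blast
  qed
  then obtain A where A: "A \<in> lifts H" "\<forall>i<k. par (x i v* A) (y i)" by blast
  have "map (\<lambda>x. proj_act x (scalar_matrices #>\<^bsub>GL\<^esub> A)) X = Y"
  proof (rule nth_equalityI)
    fix i assume "i < length (map (\<lambda>x. proj_act x (scalar_matrices #>\<^bsub>GL\<^esub> A)) X)"
    then have i: "i < k" using len by simp
    then show "map (\<lambda>x. proj_act x (scalar_matrices #>\<^bsub>GL\<^esub> A)) X ! i = Y ! i"
      using A(2) x[OF i] y[OF i] proj_act_span[of "y i" "x i" A] len by simp
  qed (simp add: len)
  then show "\<exists>h\<in>H. map (\<lambda>x. proj_act x h) X = Y" unfolding ex_lift[OF H] using A(1) by blast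
qed (use r in simp_all)

text \<open>Fewer than \<open>card S\<close> indices always miss some \<open>j\<close>, so the two
  tuples are \<open>r\<close>-equivalent for every \<open>r < card S\<close> without being
  conjugate. The index type is left open so that sums and products can serve.\<close>

lemma relational_complexity_ge:
  fixes H :: "('a::field^'n^'n) set set" and x y :: "'i \<Rightarrow> 'a^'n"
  assumes H: "H \<subseteq> carrier PGL" and S: "finite S"
    and nz: "\<And>i. i \<in> S \<Longrightarrow> x i \<noteq> 0" "\<And>i. i \<in> S \<Longrightarrow> y i \<noteq> 0"
    and proper: "\<And>j. j \<in> S \<Longrightarrow> \<exists>A\<in>lifts H. \<forall>i\<in>S - {j}. par (x i v* A) (y i)"
    and no: "\<not> (\<exists>A\<in>lifts H. \<forall>i\<in>S. par (x i v* A) (y i))"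
  shows "enat (card S) \<le> relational_complexity H proj_act proj_points"
  unfolding relational_complexity_def
proof (rule Inf_greatest, clarify)
  fix r assume all: "\<forall>k\<ge>r. \<forall>X\<in>lists proj_points. \<forall>Y\<in>lists proj_points.
    length X = k \<longrightarrow> length Y = k \<longrightarrow> equivalent_under H proj_act r X Y \<longrightarrow>
    (\<exists>h\<in>H. map (\<lambda>x. proj_act x h) X = Y)"
  show "enat (card S) \<le> enat r"
  proof (rule ccontr)
    assume "\<not> enat (card S) \<le> enat r"
    then have r: "r < card S" by simp
    obtain e where e: "bij_betw e {..<card S} S"
      using ex_bij_betw_nat_finite[OF S] by (auto simp: atLeast0LessThan)
    have eS: "e i \<in> S" if "i < card S" for i using e that by (auto simp: bij_betw_def)
    define X where "X = map (\<lambda>i. vec.span {x (e i)}) [0..<card S]"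
    define Y where "Y = map (\<lambda>i. vec.span {y (e i)}) [0..<card S]"
    have XY: "X \<in> lists proj_points" "Y \<in> lists proj_points" "length X = card S" "length Y = card S"
      using nz[OF eS] unfolding X_def Y_def by (auto simp: proj_points_iff) blast+
    have act: "proj_act (X ! i) (scalar_matrices #>\<^bsub>GL\<^esub> A) = Y ! i \<longleftrightarrow> par (x (e i) v* A) (y (e i))"
      if "i < card S" for i A
      using that nz eS by (simp add: X_def Y_def proj_act_span)
    have "equivalent_under H proj_act r X Y"
      unfolding equivalent_under_def XY
    proof (intro conjI refl allI impI)
      fix I assume I: "I \<subseteq> {..<card S}" "card I = r"
      then have "I \<noteq> {..<card S}" using r by auto
      then obtain j where j: "j < card S" "j \<notin> I" using I by blast
      obtain A where A: "A \<in> lifts H" "\<forall>i\<in>S - {e j}. par (x i v* A) (y i)"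
        using proper[OF eS[OF j(1)]] by blast
      have "e i \<noteq> e j" if "i \<in> I" for i
        using that j I e by (metis bij_betw_def inj_on_eq_iff lessThan_iff subsetD)
      then have "proj_act (X ! i) (scalar_matrices #>\<^bsub>GL\<^esub> A) = Y ! i" if "i \<in> I" for i
        using A(2) I eS act[of i A] that by blast
      then show "\<exists>h\<in>H. \<forall>i\<in>I. proj_act (X ! i) h = Y ! i"
        unfolding ex_lift[OF H] using A(1) by blast
    qed
    then have "\<exists>h\<in>H. map (\<lambda>x. proj_act x h) X = Y" 
      using all[rule_format, of "card S" X Y] r XY by simp
    then obtain A where A: "A \<in> lifts H" "map (\<lambda>x. proj_act x (scalar_matrices #>\<^bsub>GL\<^esub> A)) X = Y"
      unfolding ex_lift[OF H] by blast
    have "par (x i v* A) (y i)" if "i \<in> S" for i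
    proof -
      have "i \<in> e ` {..<card S}" using bij_betw_imp_surj_on[OF e] that by simp
      then obtain j where j: "j < card S" "i = e j" by blast
      have "Y ! j = map (\<lambda>x. proj_act x (scalar_matrices #>\<^bsub>GL\<^esub> A)) X ! j" using A(2) by simp
      then show ?thesis using act[OF j(1), of A] j XY(3) by simp
    qed
    then show False using no A(1) by blast
  qed
qed

section \<open>Intermediate groups as determinant conditions\<close>

lemma det_mat: "det (mat c :: 'a::field^'n^'n) = c ^ CARD('n)"
  by (subst det_diagonal) (auto simp: mat_def)

text \<open>Matrices of equal determinant differ by a factor in \<open>SL\<close>, whose class lies
  in \<open>H\<close>, so the determinants of lifts decide membership. Scalar matrices represent the
  identity and supply the powers; a matrix outside \<open>lifts H\<close> supplies
  \<open>d\<close>.\<close>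

lemma lifts_det:
  fixes H :: "('a::field^'n^'n) set set"
  assumes sub: "subgroup H PGL" and PSL: "PSL \<lhd> PGL\<lparr>carrier := H\<rparr>" and ne: "H \<noteq> carrier PGL"
  obtains D d where "\<And>A. A \<in> lifts H \<longleftrightarrow> det A \<in> D"
    "\<And>a b. a \<in> D \<Longrightarrow> b \<in> D \<Longrightarrow> a * b \<in> D" "\<And>c. c \<noteq> 0 \<Longrightarrow> c ^ CARD('n) \<in> D"
    "d \<noteq> 0" "d \<notin> D"
proof -
  interpret N: normal scalar_matrices "GL :: ('a^'n^'n) monoid" by (rule scalar_matrices_normal)
  have carr: "A \<in> carrier GL \<longleftrightarrow> invertible A" for A :: "'a^'n^'n" by (simp add: GL_def)
  have HP: "H \<subseteq> carrier PGL" using sub by (rule subgroup.subset)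
  have mult: "A ** B \<in> lifts H" if "A \<in> lifts H" "B \<in> lifts H" for A B
  proof -
    have i: "invertible A" "invertible B" using that by (auto simp: lifts_def)
    have "(scalar_matrices #>\<^bsub>GL\<^esub> A) \<otimes>\<^bsub>PGL\<^esub> (scalar_matrices #>\<^bsub>GL\<^esub> B) \<in> H"
      using that sub by (auto simp: lifts_def intro: subgroup.m_closed)
    also have "(scalar_matrices #>\<^bsub>GL\<^esub> A) \<otimes>\<^bsub>PGL\<^esub> (scalar_matrices #>\<^bsub>GL\<^esub> B) = scalar_matrices #>\<^bsub>GL\<^esub> (A ** B)"
      using N.rcos_sum[of A B] i by (simp add: PGL_def FactGroup_def carr) (simp add: GL_def)
    finally show ?thesis using i by (simp add: lifts_def invertible_mult)
  qed
  have "PSL \<subseteq> H" using subgroup.subset[OF normal_imp_subgroup[OF PSL]] by simp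
  then have SL: "A \<in> lifts H" if "det A = 1" for A
    using that by (auto simp: lifts_def PSL_def SL_def invertible_det_nz)
  have scal: "mat c \<in> lifts H" if "c \<noteq> 0" for c :: 'a
  proof -
    have "(mat c :: 'a^'n^'n) \<in> scalar_matrices" using that by (auto simp: scalar_matrices_def)
    then have "scalar_matrices #>\<^bsub>GL\<^esub> (mat c :: 'a^'n^'n) = scalar_matrices"
      using N.subset by (intro N.coset_join2 N.subgroup_axioms) auto
    also have "\<dots> = \<one>\<^bsub>PGL\<^esub>" by (simp add: PGL_def FactGroup_def)
    also have "\<dots> \<in> H" using sub by (rule subgroup.one_closed)
    finally show ?thesis using that by (simp add: lifts_def invertible_det_nz det_mat)
  qed
  have dets: "B \<in> lifts H" if "A \<in> lifts H" "det A = det B" for A B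
  proof -
    have "invertible A" using that by (simp add: lifts_def)
    then obtain A' where A': "A ** A' = mat 1" unfolding invertible_def by blast
    have "det A * det A' = 1" using arg_cong[OF A', of det] by (simp add: det_mul)
    then have "det (A' ** B) = 1" using that by (simp add: det_mul mult.commute)
    then have "A ** (A' ** B) \<in> lifts H" using mult that SL by blast
    then show ?thesis by (simp add: matrix_mul_assoc A')
  qed
  obtain C where "C \<in> carrier PGL" "C \<notin> H" using HP ne by blast
  then obtain g where g: "invertible g" "g \<notin> lifts H" by (auto simp: carrier_PGL lifts_def)
  show thesis
  proof (rule that[of "det ` lifts H" "det g"])
    show "A \<in> lifts H \<longleftrightarrow> det A \<in> det ` lifts H" for A using dets by force
    show "a * b \<in> det ` lifts H" if ab: "a \<in> det ` lifts H" "b \<in> det ` lifts H" for a b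
    proof -
      obtain A B where "A \<in> lifts H" "B \<in> lifts H" "a = det A" "b = det B" using ab by blast
      then show ?thesis using mult[of A B] by (simp add: det_mul[symmetric])
    qed
    show "c ^ CARD('n) \<in> det ` lifts H" if "c \<noteq> 0" for c
      using scal[OF that] by (metis det_mat image_eqI)
    show "det g \<noteq> 0" using g by (simp add: invertible_det_nz)
    show "det g \<notin> det ` lifts H" using g dets by auto
  qed
qed

text \<open>In the row action \<open>axis i 1\<close> is scaled by \<open>t i\<close> for
  \<open>i \<noteq> s\<close>, while \<open>axis s 1\<close> goes to \<open>u\<close>: with nonzero
  \<open>t i\<close>, all coordinate points but one stay in place.\<close>

definition row_diag :: "'n \<Rightarrow> 'a::field^'n \<Rightarrow> ('n \<Rightarrow> 'a) \<Rightarrow> 'a^'n^'n" where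
  "row_diag s u t = (\<chi> i j. if i = s then u $ j else if i = j then t i else 0)"

text \<open>A permutation other than the identity moves some \<open>i \<noteq> s\<close> and so
  meets a zero entry; only the diagonal product remains.\<close>

lemma det_row_diag:
  fixes u :: "'a::field^'n"
  shows "det (row_diag s u t) = u $ s * (\<Prod>i\<in>UNIV - {s}. t i)"
proof -
  let ?A = "row_diag s u t" and ?PU = "{p. p permutes (UNIV :: 'n set)}"
  have "(\<Prod>i\<in>UNIV. ?A $ i $ p i) = 0" if p: "p permutes UNIV" "p \<noteq> id" for p :: "'n \<Rightarrow> 'n"
  proof -
    obtain k where k: "p k \<noteq> k" using p(2) by (auto simp: fun_eq_iff)
    have "\<exists>i. i \<noteq> s \<and> p i \<noteq> i"
    proof (cases "k = s")
      case True
      then have "p (p s) \<noteq> p s" using k permutes_inj[OF p(1)] by (simp add: inj_eq)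
      then show ?thesis using k True by blast
    qed (use k in blast)
    then obtain i where "i \<noteq> s" "p i \<noteq> i" by blast
    then have "?A $ i $ p i = 0" by (simp add: row_diag_def)
    then show ?thesis by (intro prod_zero) auto
  qed
  then have "det ?A = (\<Sum>p\<in>{id}. of_int (sign p) * (\<Prod>i\<in>UNIV. ?A $ i $ p i))"
    unfolding det_def by (intro sum.mono_neutral_right) (auto simp: finite_permutations permutes_id)
  also have "\<dots> = (\<Prod>i\<in>UNIV. ?A $ i $ i)" by (simp add: sign_id)
  also have "\<dots> = ?A $ s $ s * (\<Prod>i\<in>UNIV - {s}. ?A $ i $ i)" by (rule prod.remove) auto
  also have "(\<Prod>i\<in>UNIV - {s}. ?A $ i $ i) = (\<Prod>i\<in>UNIV - {s}. t i)"
    by (intro prod.cong) (auto simp: row_diag_def)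
  finally show ?thesis by (simp add: row_diag_def)
qed

lemma vector_mult_row_diag:
  fixes u v :: "'a::field^'n"
  shows "(v v* row_diag s u t) $ k = (if k = s then v $ s * u $ s else v $ k * t k + v $ s * u $ k)"
proof -
  have "(v v* row_diag s u t) $ k = (\<Sum>i\<in>UNIV. v $ i * row_diag s u t $ i $ k)"
    by (simp add: vector_matrix_mult_def)
  also have "\<dots> = v $ s * u $ k + (\<Sum>i\<in>UNIV - {s}. v $ i * row_diag s u t $ i $ k)"
    by (subst sum.remove[of _ s]) (auto simp: row_diag_def)
  also have "(\<Sum>i\<in>UNIV - {s}. v $ i * row_diag s u t $ i $ k) =
      (\<Sum>i\<in>UNIV - {s}. if k = i then v $ i * t i else 0)"
    by (intro sum.cong) (auto simp: row_diag_def)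
  also have "\<dots> = (if k = s then 0 else v $ k * t k)" by (simp add: sum.delta')
  finally show ?thesis by simp
qed

section \<open>Lower bounds\<close>

lemma axis_mult_matrix: "axis i 1 v* A = (A :: 'a::field^'n^'n) $ i"
  by (simp add: vec_eq_iff vector_matrix_mult_def axis_def if_distrib[of "\<lambda>x. x * _"] sum.delta cong: if_cong)

lemma vector_mult_diagonal:
  fixes A :: "'a::field^'n^'n"
  assumes "\<And>i j. i \<noteq> j \<Longrightarrow> A $ i $ j = 0"
  shows "(v v* A) $ j = v $ j * A $ j $ j"
proof -
  have "(v v* A) $ j = (\<Sum>i\<in>UNIV. if i = j then v $ j * A $ j $ j else 0)"
    unfolding vector_matrix_mult_def vec_lambda_beta using assms by (intro sum.cong) auto
  then show ?thesis by simp
qed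

text \<open>The axes are independent, but in the second tuple \<open>axis p 1\<close> is replaced by
  the sum of the other axes. After omission of any index both tuples are independent.\<close>

lemma relational_complexity_PGL_ge_n:
  assumes n: "CARD('n::finite) \<ge> 2"
  shows "enat CARD('n) \<le> relational_complexity (carrier (PGL :: ('a::field^'n^'n) set monoid)) proj_act proj_points"
proof -
  obtain p :: 'n where True by simp
  define x :: "'n \<Rightarrow> 'a^'n" where "x i = axis i 1" for i
  define y :: "'n \<Rightarrow> 'a^'n" where "y i = (if i = p then (\<chi> k. if k = p then 0 else 1) else axis i 1)" for i
  have "card {p} < CARD('n)" using n by simp
  then have "UNIV \<noteq> {p}" by (metis less_irrefl)
  then obtain q where q: "q \<noteq> p" by blast
  have "enat (card (UNIV :: 'n set)) \<le>
      relational_complexity (carrier (PGL :: ('a^'n^'n) set monoid)) proj_act proj_points"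
  proof (rule relational_complexity_ge[of _ _ x y])
    show "x i \<noteq> 0" for i by (simp add: x_def axis_eq_0_iff)
    show "y i \<noteq> 0" for i
    proof -
      have "y i $ (if i = p then q else i) = 1" using q by (simp add: y_def)
      then show ?thesis by (metis zero_index zero_neq_one)
    qed
    fix j :: 'n
    show "\<exists>A\<in>lifts (carrier PGL). \<forall>i\<in>UNIV - {j}. par (x i v* A) (y i)"
    proof (cases "j = p")
      case True
      have "invertible (mat 1 :: 'a^'n^'n)" by (simp add: invertible_det_nz)
      then show ?thesis using True by (intro bexI[of _ "mat 1"]) (auto simp: lifts_PGL x_def y_def)
    next
      case False
      \<comment> \<open>It sends \<open>axis p 1\<close> to the sum of the other axes, the omitted
        \<open>axis j 1\<close> to \<open>axis p 1\<close>, and fixes the remaining axes.\<close>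
      define f :: "'a^'n \<Rightarrow> 'a^'n" where
        "f v = (\<chi> k. if k = p then v $ j else if k = j then v $ p else v $ k + v $ p)" for v
      have "inj f"
      proof (rule injI)
        fix u v assume "f u = f v"
        then have eq: "f u $ k = f v $ k" for k by simp
        have "u $ j = v $ j" "u $ p = v $ p" using eq[of p] eq[of j] False by (auto simp: f_def)
        moreover have "u $ k = v $ k" if "k \<noteq> p" "k \<noteq> j" for k
          using eq[of k] that \<open>u $ p = v $ p\<close> by (auto simp: f_def)
        ultimately show "u = v" unfolding vec_eq_iff by metis
      qed
      moreover have "lin f" by (rule lin_I) (auto simp: f_def vec_eq_iff algebra_simps)
      ultimately obtain A where A: "invertible A" "f = (\<lambda>v. v v* A)"
        using lin_iso_matrix[of f] by (auto simp: lin_iso_def)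
      have "f (x i) = y i" if "i \<noteq> j" for i
        using False that by (auto simp: f_def x_def y_def vec_eq_iff axis_def)
      then have "x i v* A = y i" if "i \<noteq> j" for i using that A(2) by metis
      then show ?thesis using A(1) by (intro bexI[of _ A]) (auto simp: lifts_PGL)
    qed
  next
    show "\<not> (\<exists>A\<in>lifts (carrier PGL). \<forall>i\<in>UNIV. par (x i v* A) (y i))"
    proof safe
      fix A :: "'a^'n^'n" assume "A \<in> lifts (carrier PGL)" and par: "\<forall>i\<in>UNIV. par (x i v* A) (y i)"
      then have iso: "lin_iso (\<lambda>v. v v* A)" by (auto simp: lin_iso_matrix lifts_PGL)
      let ?I = "x ` (UNIV - {p})"
      have "y p = (\<Sum>i\<in>UNIV - {p}. x i)"
        by (auto simp: y_def x_def vec_eq_iff axis_def sum.delta' if_distrib cong: if_cong)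
      also have "\<dots> \<in> vec.span ?I" by (intro vec.span_sum vec.span_base) auto
      finally have "x p v* A \<in> vec.span ?I" using par par_in_span by blast
      moreover have "par (u v* A) u" if u: "u \<in> ?I" for u
      proof -
        obtain i where "i \<noteq> p" "u = x i" using u by blast
        then show ?thesis using bspec[OF par, of i] by (simp add: x_def y_def)
      qed
      ultimately have "x p \<in> vec.span ?I" using lin_iso_span_iff[OF iso, of ?I "x p"] by simp
      moreover have "vec.span ?I \<subseteq> {v. v $ p = 0}"
        by (rule vec.span_minimal) (auto simp: x_def axis_def intro!: vec.subspaceI)
      ultimately show False by (auto simp: x_def)
    qed
  qed simp_all
  then show ?thesis .
qed

text \<open>
  The tuples are the standard frame followed by \<open>w\<close> and by \<open>w'\<close>. If \<open>axis s 1\<close> is omitted, the map is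
  given by its eigenvalues \<open>t k\<close> on the other axes and \<open>\<kappa>\<close> on the all-ones vector.
\<close>

lemma relational_complexity_ge_frame:
  fixes H :: "('a::field^'n^'n) set set" and w w' :: "'a^'n"
  assumes H: "H \<subseteq> carrier PGL" and D: "\<And>A. det A \<in> D \<Longrightarrow> A \<in> lifts H" and "1 \<in> D"
    and w: "w $ p = 1" "w' $ p = 1" "w \<noteq> w'"
    and axis: "\<And>s. \<exists>t \<kappa> \<rho>. \<kappa> \<noteq> 0 \<and> \<rho> \<noteq> 0 \<and> (\<forall>k. t k \<noteq> 0) \<and> \<kappa> * (\<Prod>k\<in>UNIV - {s}. t k) \<in> D \<and>
        w $ s * \<kappa> = \<rho> * w' $ s \<and> (\<forall>k. k \<noteq> s \<longrightarrow> w $ k * t k + w $ s * (\<kappa> - t k) = \<rho> * w' $ k)"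
    and diag: "\<exists>t. (\<forall>k. t k \<noteq> 0 \<and> w $ k * t k = w' $ k) \<and> (\<Prod>k\<in>UNIV. t k) \<in> D"
  shows "enat (CARD('n) + 2) \<le> relational_complexity H proj_act proj_points"
proof -
  define x :: "'n + bool \<Rightarrow> 'a^'n" where "x = case_sum (\<lambda>i. axis i 1) (\<lambda>b. if b then w else (\<chi> k. 1))"
  define y :: "'n + bool \<Rightarrow> 'a^'n" where "y = case_sum (\<lambda>i. axis i 1) (\<lambda>b. if b then w' else (\<chi> k. 1))"
  have "enat (card (UNIV :: ('n + bool) set)) \<le> relational_complexity H proj_act proj_points"
  proof (rule relational_complexity_ge[OF H, of _ x y])
    have "w \<noteq> 0" "w' \<noteq> 0" "(\<chi> k. 1) \<noteq> (0 :: 'a^'n)"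
      using w by (auto simp: vec_eq_iff intro!: exI[of _ p])
    then show "x i \<noteq> 0" "y i \<noteq> 0" for i
      by (auto simp: x_def y_def axis_eq_0_iff split: sum.split)
    fix j :: "'n + bool"
    show "\<exists>A\<in>lifts H. \<forall>i\<in>UNIV - {j}. par (x i v* A) (y i)"
    proof (cases j)
      case (Inl s)
      obtain t \<kappa> \<rho> where *: "\<kappa> \<noteq> 0" "\<rho> \<noteq> 0" "\<And>k. t k \<noteq> 0" "\<kappa> * (\<Prod>k\<in>UNIV - {s}. t k) \<in> D"
        "w $ s * \<kappa> = \<rho> * w' $ s" "\<And>k. k \<noteq> s \<Longrightarrow> w $ k * t k + w $ s * (\<kappa> - t k) = \<rho> * w' $ k"
        using axis[of s] by blast
      \<comment> \<open>Row \<open>s\<close> makes every column sum equal to \<kappa>, so that the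
        all-ones vector is an eigenvector; \<rho> is the factor between the image of
        \<open>w\<close> and \<open>w'\<close>.\<close>
      define A where "A = row_diag s (\<chi> k. if k = s then \<kappa> else \<kappa> - t k) t"
      have "A \<in> lifts H" using * by (intro D) (simp add: A_def det_row_diag)
      moreover have "par (x i v* A) (y i)" if i: "i \<noteq> j" for i
      proof (cases i)
        case (Inl k)
        then have "k \<noteq> s" using i \<open>j = Inl s\<close> by auto
        then have "x i v* A = t k *s y i"
          using Inl by (auto simp: A_def x_def y_def vec_eq_iff vector_mult_row_diag axis_def)
        then show ?thesis using * by (simp add: par_scale)
      next
        case (Inr b)
        have "x i v* A = (if b then \<rho> else \<kappa>) *s y i"
          using Inr * by (auto simp: A_def x_def y_def vec_eq_iff vector_mult_row_diag)
        then show ?thesis using * by (simp add: par_scale)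
      qed
      ultimately show ?thesis by blast
    next
      case (Inr b)
      show ?thesis
      proof (cases b)
        case True
        have "mat 1 \<in> lifts H" using \<open>1 \<in> D\<close> by (intro D) simp
        then show ?thesis
          using True Inr by (intro bexI[of _ "mat 1"]) (auto simp: x_def y_def split: sum.split)
      next
        case False
        obtain t where t: "\<And>k. t k \<noteq> 0" "\<And>k. w $ k * t k = w' $ k" "(\<Prod>k\<in>UNIV. t k) \<in> D"
          using diag by blast
        define A where "A = row_diag p (t p *s axis p 1) t"
        have "det A = (\<Prod>k\<in>UNIV. t k)"
          by (simp add: A_def det_row_diag prod.remove[of UNIV p])
        then have "A \<in> lifts H" using t D by simp
        moreover have "par (x i v* A) (y i)" if i: "i \<noteq> j" for i
        proof (cases i)
          case (Inl k)
          then have "x i v* A = t k *s y i"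
            by (auto simp: A_def x_def y_def vec_eq_iff vector_mult_row_diag axis_def)
          then show ?thesis using t by (simp add: par_scale)
        next
          case Inr': (Inr b')
          then have "b'" using Inr i False by auto
          have "x i v* A = y i"
            using Inr' t(2) \<open>b'\<close> by (auto simp: A_def x_def y_def vec_eq_iff vector_mult_row_diag axis_def)
          then show ?thesis by simp
        qed
        ultimately show ?thesis by blast
      qed
    qed
  next
    show "\<not> (\<exists>A\<in>lifts H. \<forall>i\<in>UNIV. par (x i v* A) (y i))"
    proof safe
      fix A :: "'a^'n^'n" assume "A \<in> lifts H" and par: "\<forall>i\<in>UNIV. par (x i v* A) (y i)"
      have row: "par (A $ i) (axis i 1)" for i
        using bspec[OF par, of "Inl i"] by (simp add: x_def y_def axis_mult_matrix)
      have off: "A $ i $ j = 0" if "i \<noteq> j" for i j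
        using row[of i] that by (auto simp: par_def axis_def)
      obtain c where c: "c \<noteq> 0" "(\<chi> k. 1) v* A = c *s (\<chi> k. 1)"
        using bspec[OF par, of "Inr False"] by (auto simp: x_def y_def par_def)
      have Ac: "A $ k $ k = c" for k
        using arg_cong[OF c(2), of "\<lambda>v. v $ k"] vector_mult_diagonal[OF off, of "\<chi> k. 1" k] by simp
      obtain d where d: "d \<noteq> 0" "w v* A = d *s w'"
        using bspec[OF par, of "Inr True"] by (auto simp: x_def y_def par_def)
      have wd: "w $ k * c = d * w' $ k" for k
        using arg_cong[OF d(2), of "\<lambda>v. v $ k"] vector_mult_diagonal[OF off, of w k] by (simp add: Ac)
      have "c = d" using wd[of p] w by simp
      then have "w = w'" using wd c(1) by (auto simp: vec_eq_iff)
      then show False using w by blast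
    qed
  qed simp_all
  then show ?thesis by (simp add: card_UNIV_sum)
qed

text \<open>The last points are at positions \<open>a\<close> and \<open>b\<close> on the line
  through the axes \<open>p\<close> and \<open>q\<close>. The two conditions on \<open>D\<close>
  concern the determinants that arise when axis \<open>p\<close> or axis \<open>q\<close> is
  omitted; every other omission can be realised with determinant 1.\<close>

lemma relational_complexity_ge_line:
  fixes H :: "('a::field^'n^'n) set set" and a b :: 'a
  assumes n: "CARD('n) \<ge> 3"
    and H: "H \<subseteq> carrier PGL" and D: "\<And>A. det A \<in> D \<Longrightarrow> A \<in> lifts H" and "1 \<in> D"
    and ab: "a \<noteq> 0" "a \<noteq> 1" "b \<noteq> 0" "b \<noteq> 1" "a \<noteq> b"
    and D1: "(1 - b) / (1 - a) \<in> D" and D2: "a * (1 - b) / (b * (1 - a)) \<in> D"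
  shows "enat (CARD('n) + 2) \<le> relational_complexity H proj_act proj_points"
proof -
  obtain p q r :: 'n where pqr: "p \<noteq> q" "p \<noteq> r" "q \<noteq> r"
  proof -
    obtain T :: "'n set" where "card T = 3" using obtain_subset_with_card_n[OF n] by metis
    then show thesis using that by (auto simp: card_3_iff)
  qed
  define w :: "'a \<Rightarrow> 'a^'n" where "w c = (\<chi> k. if k = p then 1 else if k = q then c else 0)" for c
  have w: "w c $ k = (if k = p then 1 else if k = q then c else 0)" for c k by (simp add: w_def)
  have prod1: "(\<Prod>k\<in>UNIV - {s}. if k = j then c else 1) = (if j = s then 1 else c)" for s j :: 'n and c :: 'a
    by (simp add: prod.delta)
  have a1: "1 - a \<noteq> 0" "1 - b \<noteq> 0" using ab by auto
  show ?thesis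
  proof (rule relational_complexity_ge_frame[OF H D \<open>1 \<in> D\<close>, of "w a" p "w b"])
    show "w a $ p = 1" "w b $ p = 1" by (simp_all add: w)
    have "w a $ q \<noteq> w b $ q" using ab pqr by (simp add: w)
    then show "w a \<noteq> w b" by auto
    fix s :: 'n
    show "\<exists>t \<kappa> \<rho>. \<kappa> \<noteq> 0 \<and> \<rho> \<noteq> 0 \<and> (\<forall>k. t k \<noteq> 0) \<and> \<kappa> * (\<Prod>k\<in>UNIV - {s}. t k) \<in> D \<and>
        w a $ s * \<kappa> = \<rho> * w b $ s \<and>
        (\<forall>k. k \<noteq> s \<longrightarrow> w a $ k * t k + w a $ s * (\<kappa> - t k) = \<rho> * w b $ k)"
    proof -
      consider "s = p" | "s = q" | "s \<noteq> p" "s \<noteq> q" by blast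
      then show ?thesis
      proof cases
        case 1
        show ?thesis
          by (rule exI[of _ "\<lambda>k. if k = q then (1 - b) / (1 - a) else 1"], rule exI[of _ 1], rule exI[of _ 1])
            (use 1 pqr ab a1 D1 in \<open>auto simp: w prod1 field_simps\<close>)
      next
        case 2
        \<comment> \<open>The eigenvalue at \<open>p\<close> divided by \<open>a\<close>; the
          following identities verify the equation at coordinate \<open>p\<close> with \<rho> equal
          to \<open>a / b\<close>.\<close>
        define X where "X = (1 - b) / (b * (1 - a))"
        have "X * (1 - a) = (1 - b) / b" using a1 by (simp add: X_def)
        moreover have "a * X + a * (1 - a * X) = a * (X * (1 - a)) + a" by (simp add: algebra_simps)
        moreover have "a * ((1 - b) / b) + a = a / b" using ab by (simp add: field_simps)
        ultimately have "a * X + a * (1 - a * X) = a / b" by simp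
        then show ?thesis
          by (intro exI[of _ "\<lambda>k. if k = p then a * (1 - b) / (b * (1 - a)) else 1"] exI[of _ 1] exI[of _ "a / b"])
            (use 2 pqr ab a1 D2 in \<open>auto simp: w prod1 X_def\<close>)
      next
        case 3
        show ?thesis
          by (rule exI[of _ "\<lambda>k. if k = q then b / a else 1"], rule exI[of _ "a / b"], rule exI[of _ 1])
            (use 3 pqr ab \<open>1 \<in> D\<close> in \<open>auto simp: w prod1\<close>)
      qed
    qed
  next
    \<comment> \<open>At the third index \<open>r\<close> both vectors vanish, so the entry there is
      free to cancel \<open>b / a\<close>.\<close>
    let ?t = "\<lambda>k. if k = q then b / a else if k = r then a / b else 1"
    have "(\<Prod>k\<in>UNIV. ?t k) = b / a * (\<Prod>k\<in>UNIV - {q}. ?t k)" by (subst prod.remove[of _ q]) auto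
    also have "(\<Prod>k\<in>UNIV - {q}. ?t k) = (\<Prod>k\<in>UNIV - {q}. if k = r then a / b else 1)"
      by (rule prod.cong) auto
    finally have "(\<Prod>k\<in>UNIV. ?t k) = 1" using ab pqr by (simp add: prod1)
    then show "\<exists>t. (\<forall>k. t k \<noteq> 0 \<and> w a $ k * t k = w b $ k) \<and> (\<Prod>k\<in>UNIV. t k) \<in> D"
      using pqr ab \<open>1 \<in> D\<close> by (intro exI[of _ ?t]) (auto simp: w)
  qed
qed

text \<open>The tuples end in \<open>(1, \<omega>, \<omega>\<^sup>2)\<close> and \<open>(1, \<omega>\<^sup>2, \<omega>)\<close>, with \<open>\<omega>\<^sup>2\<close> written as \<open>- \<omega> - 1\<close>.\<close>

lemma relational_complexity_ge_cube_root:
  fixes H :: "('a::field^'n^'n) set set" and \<omega> :: 'a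
  assumes n: "CARD('n) = 3"
    and H: "H \<subseteq> carrier PGL" and D: "\<And>A. det A \<in> D \<Longrightarrow> A \<in> lifts H" and "1 \<in> D"
    and \<omega>: "\<omega> ^ 3 = 1" "\<omega> \<noteq> 1"
  shows "enat (CARD('n) + 2) \<le> relational_complexity H proj_act proj_points"
proof -
  obtain p q r :: 'n where pqr: "p \<noteq> q" "p \<noteq> r" "q \<noteq> r" and U: "UNIV = {p, q, r}"
    using n by (auto simp: card_3_iff)
  have \<omega>0: "\<omega> \<noteq> 0" using \<omega> by auto
  have "(\<omega> - 1) * (\<omega>\<^sup>2 + \<omega> + 1) = 0" using \<omega>(1) by (simp add: algebra_simps power2_eq_square power3_eq_cube)
  then have "\<omega>\<^sup>2 + \<omega> + 1 = 0" using \<omega>(2) by simp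
  moreover have "\<omega>\<^sup>2 = (\<omega>\<^sup>2 + \<omega> + 1) - \<omega> - 1" by simp
  ultimately have s0: "\<omega>\<^sup>2 = - \<omega> - 1" by simp
  then have "\<omega>\<^sup>2 = - (\<omega> + 1)" by simp
  then have nz: "\<omega> + 1 \<noteq> 0" using \<omega>0 by (metis minus_zero power_not_zero)
  then have nz': "- \<omega> \<noteq> 1" by (metis add.right_inverse)
  from s0 have s1: "\<omega> * \<omega> = - \<omega> - 1" by (simp add: power2_eq_square)
  then have s2: "\<omega> * (\<omega> * c) = - (\<omega> * c) - c" for c by (simp add: mult.assoc[symmetric] left_diff_distrib)
  define v :: "'a \<Rightarrow> 'a \<Rightarrow> 'a^'n" where "v c d = (\<chi> k. if k = p then 1 else if k = q then c else d)" for c d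
  have v: "v c d $ p = 1" "v c d $ q = c" "v c d $ r = d" for c d using pqr by (simp_all add: v_def)
  have Dif: "UNIV - {p} = {q, r}" "UNIV - {q} = {p, r}" "UNIV - {r} = {p, q}" using U pqr by auto
  have all: "(\<forall>k. P k) \<longleftrightarrow> P p \<and> P q \<and> P r" for P using U by (metis UNIV_I empty_iff insert_iff)
  show ?thesis
  proof (rule relational_complexity_ge_frame[OF H D \<open>1 \<in> D\<close>, of "v \<omega> (- \<omega> - 1)" p "v (- \<omega> - 1) \<omega>"])
    show "v \<omega> (- \<omega> - 1) $ p = 1" "v (- \<omega> - 1) \<omega> $ p = 1" by (simp_all add: v)
    have "\<omega> \<noteq> \<omega>\<^sup>2" using \<omega>(2) \<omega>0 by (simp add: power2_eq_square)
    then have "\<omega> \<noteq> - \<omega> - 1" using s0 by simp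
    then show "v \<omega> (- \<omega> - 1) \<noteq> v (- \<omega> - 1) \<omega>" using v(2) by metis
    fix s :: 'n
    consider "s = p" | "s = q" | "s = r" using U by blast
    then show "\<exists>t \<kappa> \<rho>. \<kappa> \<noteq> 0 \<and> \<rho> \<noteq> 0 \<and> (\<forall>k. t k \<noteq> 0) \<and> \<kappa> * (\<Prod>k\<in>UNIV - {s}. t k) \<in> D \<and>
        v \<omega> (- \<omega> - 1) $ s * \<kappa> = \<rho> * v (- \<omega> - 1) \<omega> $ s \<and>
        (\<forall>k. k \<noteq> s \<longrightarrow> v \<omega> (- \<omega> - 1) $ k * t k + v \<omega> (- \<omega> - 1) $ s * (\<kappa> - t k) = \<rho> * v (- \<omega> - 1) \<omega> $ k)"
    proof cases
      case 1
      \<comment> \<open>In all three cases the two eigenvalues are \<open>\<omega> + 1\<close> and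
        \<open>- \<omega>\<close>, whose product is 1 because
        \<open>\<omega>\<^sup>2 + \<omega> + 1 = 0\<close>.\<close>
      show ?thesis
        by (rule exI[of _ "\<lambda>k. if k = q then \<omega> + 1 else - \<omega>"], rule exI[of _ 1], rule exI[of _ 1])
          (use 1 pqr nz nz' \<omega>0 \<open>1 \<in> D\<close> in \<open>auto simp: Dif all v s1 s2 algebra_simps\<close>)
    next
      case 2
      show ?thesis
        by (rule exI[of _ "\<lambda>k. if k = r then \<omega> + 1 else - \<omega>"], rule exI[of _ 1], rule exI[of _ "- \<omega> - 1"])
          (use 2 pqr nz nz' \<omega>0 \<open>1 \<in> D\<close> in \<open>auto simp: Dif all v s1 s2 algebra_simps\<close>)
    next
      case 3
      show ?thesis
        by (rule exI[of _ "\<lambda>k. if k = p then \<omega> + 1 else - \<omega>"], rule exI[of _ 1], rule exI[of _ \<omega>])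
          (use 3 pqr nz nz' \<omega>0 \<open>1 \<in> D\<close> in \<open>auto simp: Dif all v s1 s2 algebra_simps\<close>)
    qed
  next
    \<comment> \<open>The first vector itself serves as the diagonal: squaring its entries swaps the
      last two, and their product is \<open>\<omega> ^ 3\<close>.\<close>
    show "\<exists>t. (\<forall>k. t k \<noteq> 0 \<and> v \<omega> (- \<omega> - 1) $ k * t k = v (- \<omega> - 1) \<omega> $ k) \<and> (\<Prod>k\<in>UNIV. t k) \<in> D"
      by (rule exI[of _ "\<lambda>k. v \<omega> (- \<omega> - 1) $ k"]) 
        (use pqr nz nz' \<omega>0 \<open>1 \<in> D\<close> in \<open>auto simp: U all v s1 s2 algebra_simps\<close>)
  qed
qed

text \<open>The diagonal matrix with \<open>d\<close> at \<open>z\<close> and 1 elsewhere matches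
  the tuples, and any other match is a scalar multiple of it. Its determinant
  \<open>d * m ^ CARD('n)\<close> is not in \<open>D\<close>. Omitting one point frees the scale of
  one axis, which restores determinant 1.\<close>

lemma relational_complexity_ge_det:
  fixes H :: "('a::field^'n^'n) set set"
  assumes n: "CARD('n) \<ge> 3" and H: "H \<subseteq> carrier PGL" and D: "\<And>A. A \<in> lifts H \<longleftrightarrow> det A \<in> D"
    and mult: "\<And>a b. a \<in> D \<Longrightarrow> b \<in> D \<Longrightarrow> a * b \<in> D" and pow: "\<And>c. c \<noteq> 0 \<Longrightarrow> c ^ CARD('n) \<in> D"
    and d: "d \<noteq> 0" "d \<notin> D"
  shows "enat (2 * CARD('n) - 2) \<le> relational_complexity H proj_act proj_points"
proof -
  have D1: "1 \<in> D" using pow[of 1] by simp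
  obtain z :: 'n where True by simp
  define x :: "'n \<times> bool \<Rightarrow> 'a^'n" where "x = (\<lambda>(i, b). axis i 1 + (if b then axis z 1 else 0))"
  define y :: "'n \<times> bool \<Rightarrow> 'a^'n" where "y = (\<lambda>(i, b). axis i 1 + (if b then d *s axis z 1 else 0))"
  let ?S = "(UNIV - {z}) \<times> (UNIV :: bool set)"
  have "enat (card ?S) \<le> relational_complexity H proj_act proj_points"
  proof (rule relational_complexity_ge[OF H, of _ x y])
    fix j assume "j \<in> ?S"
    then obtain i b where j: "j = (i, b)" and i: "i \<noteq> z" by auto
    have "x j $ i = 1" "y j $ i = 1" using j i by (simp_all add: x_def y_def axis_def)
    then show "x j \<noteq> 0" "y j \<noteq> 0" by auto
    \<comment> \<open>The entry \<open>1 / d\<close> compensates the \<open>d\<close> at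
      \<open>z\<close>. If \<open>axis i 1\<close> is omitted, the entry \<open>1 - d\<close> brings
      \<open>axis i 1 + axis z 1\<close> to a multiple of its target.\<close>
    define A where "A = row_diag i (\<chi> k. if k = i then 1 / d else if k = z \<and> \<not> b then 1 - d else 0)
      (\<lambda>k. if k = z then d else 1)"
    have "det A = 1" using i d by (simp add: A_def det_row_diag prod.delta)
    then have "A \<in> lifts H" using D D1 by simp
    moreover have "par (x j' v* A) (y j')" if j': "j' \<in> ?S - {j}" for j'
    proof -
      obtain i' b' where eq: "j' = (i', b')" "i' \<noteq> z" and ne: "i' \<noteq> i \<or> b' \<noteq> b" using j' j by (cases j') auto
      have "x j' v* A = (if i' = i then 1 / d else 1) *s y j'"
        using i d ne eq(2) unfolding eq(1)
        by (auto simp: x_def y_def A_def vec_eq_iff vector_mult_row_diag axis_def)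
      then show ?thesis using d by (simp add: par_scale)
    qed
    ultimately show "\<exists>A\<in>lifts H. \<forall>i\<in>?S - {j}. par (x i v* A) (y i)" by blast
  next
    show "\<not> (\<exists>A\<in>lifts H. \<forall>i\<in>?S. par (x i v* A) (y i))"
    proof safe
      fix A :: "'a^'n^'n" assume A: "A \<in> lifts H" and par: "\<forall>i\<in>?S. par (x i v* A) (y i)"
      have "\<exists>c. A $ i = c *s axis i 1" if "i \<noteq> z" for i
        using bspec[OF par, of "(i, False)"] that by (auto simp: x_def y_def axis_mult_matrix par_def)
      then obtain c where c: "\<And>i. i \<noteq> z \<Longrightarrow> A $ i = c i *s axis i 1" by metis
      have "\<exists>m. m \<noteq> 0 \<and> A $ i + A $ z = m *s (axis i 1 + d *s axis z 1)" if "i \<noteq> z" for i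
        using bspec[OF par, of "(i, True)"] that
        by (auto simp: x_def y_def axis_mult_matrix par_def vector_matrix_left_distrib)
      then obtain m where m0: "\<And>i. i \<noteq> z \<Longrightarrow> m i \<noteq> 0"
        and m: "\<And>i. i \<noteq> z \<Longrightarrow> A $ i + A $ z = m i *s (axis i 1 + d *s axis z 1)" by metis
      have Ao: "A $ z $ k = m i * (axis i 1 $ k + d * axis z 1 $ k) - c i * axis i 1 $ k" if "i \<noteq> z" for i k
        using arg_cong[OF m[OF that], of "\<lambda>v. v $ k"] c[OF that] by (simp add: algebra_simps)
      have Aok: "A $ z $ k = 0" if "k \<noteq> z" for k
      proof -
        \<comment> \<open>With at least three indices there is an \<open>i\<close> different from
          both, and the points over \<open>i\<close> force row \<open>z\<close> to vanish at
          \<open>k\<close>.\<close>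
        have "card {z, k} < CARD('n)" using n card_insert_le_m1[of 2 "{k}" z] by simp
        then have "{z, k} \<noteq> UNIV" by (metis less_irrefl)
        then obtain i where "i \<noteq> z" "i \<noteq> k" by auto
        then show ?thesis using Ao[of i k] that by (simp add: axis_def)
      qed
      have "card {z} < CARD('n)" using n by simp
      then have "{z} \<noteq> UNIV" by (metis less_irrefl)
      then obtain i0 where i0: "i0 \<noteq> z" by auto
      have Aoo: "A $ z $ z = m i * d" if "i \<noteq> z" for i using Ao[OF that, of z] that by (simp add: axis_def)
      have mm: "m i = m i0" if "i \<noteq> z" for i using Aoo[OF that] Aoo[OF i0] d by simp
      have cm: "A $ i $ i = m i0" if "i \<noteq> z" for i
        using Ao[OF that, of i] Aok[OF that] c[OF that] mm[OF that] that by (simp add: axis_def)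
      have "det A = (\<Prod>i\<in>UNIV. A $ i $ i)"
      proof (rule det_diagonal)
        fix i k :: 'n assume "i \<noteq> k"
        then show "A $ i $ k = 0" using Aok[of k] c[of i] by (cases "i = z") (auto simp: axis_def)
      qed
      also have "\<dots> = A $ z $ z * (\<Prod>i\<in>UNIV - {z}. A $ i $ i)" by (rule prod.remove) auto
      also have "(\<Prod>i\<in>UNIV - {z}. A $ i $ i) = m i0 ^ (CARD('n) - 1)"
        by (simp add: cm card_Diff_subset)
      also have "A $ z $ z * m i0 ^ (CARD('n) - 1) = d * m i0 ^ CARD('n)"
        using n by (simp add: Aoo[OF i0] power_eq_if)
      finally have "d = det A * inverse (m i0) ^ CARD('n)" using m0[OF i0] by (simp add: power_inverse)
      also have "\<dots> \<in> D" using A D m0[OF i0] by (intro mult pow) auto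
      finally show False using d by blast
    qed
  qed simp
  moreover have "card ?S = 2 * CARD('n) - 2" by (simp add: card_cartesian_product card_Diff_subset)
  ultimately show ?thesis by simp
qed

section \<open>Upper bounds and the theorem\<close>

lemma relational_complexity_PGL_le:
  assumes n: "1 \<le> CARD('n::finite)" "CARD('n) \<le> r"
    and small: "CARD('n) + 2 \<le> r \<or> (\<forall>a::'a::field. a = 0 \<or> a = 1 \<or> a = -1)"
  shows "relational_complexity (carrier (PGL :: ('a::field^'n^'n) set monoid)) proj_act proj_points \<le> enat r"
proof (rule relational_complexity_le)
  show "1 \<le> r" using n by linarith
  fix k and x y :: "nat \<Rightarrow> 'a^'n"
  assume hyp: "\<And>I. I \<subseteq> {..<k} \<Longrightarrow> card I \<le> r \<Longrightarrow>
    \<exists>A\<in>lifts (carrier PGL). \<forall>i\<in>I. par (x i v* A) (y i)"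
  have "\<exists>f. lin_iso f \<and> (\<forall>i\<in>{..<k}. par (f (x i)) (y i))"
  proof (rule tuple_par[OF _ n(2) small])
    fix I assume "I \<subseteq> {..<k}" "card I \<le> r"
    from hyp[OF this] show "\<exists>f. lin_iso f \<and> (\<forall>i\<in>I. par (f (x i)) (y i))"
      unfolding lifts_PGL lin_iso_matrix by blast
  qed simp
  then show "\<exists>A\<in>lifts (carrier PGL). \<forall>i<k. par (x i v* A) (y i)"
    unfolding lifts_PGL lin_iso_matrix by blast
qed simp

text \<open>Some invertible \<open>g\<close> matches the tuples. A lift \<open>A\<close> that
  matches a subtuple with the same pointwise stabilizer differs from \<open>g\<close> by a map
  fixing this subtuple, hence all points, so \<open>A\<close> matches the whole tuples too.\<close>

lemma relational_complexity_subset_PGL_le: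
  fixes H :: "('a::field^'n^'n) set set"
  assumes n: "CARD('n) \<ge> 3" and H: "H \<subseteq> carrier PGL"
    and r: "CARD('n) + 2 \<le> r" "2 * CARD('n) - 2 \<le> r"
  shows "relational_complexity H proj_act proj_points \<le> enat r"
proof (rule relational_complexity_le[OF H])
  show "1 \<le> r" using r by linarith
  fix k and x y :: "nat \<Rightarrow> 'a^'n"
  assume hyp: "\<And>I. I \<subseteq> {..<k} \<Longrightarrow> card I \<le> r \<Longrightarrow> \<exists>A\<in>lifts H. \<forall>i\<in>I. par (x i v* A) (y i)"
  have lifts: "lin_iso (\<lambda>v. v v* A)" if "A \<in> lifts H" for A
    using that by (auto simp: lifts_def lin_iso_matrix)
  have "\<exists>f. lin_iso f \<and> (\<forall>i\<in>{..<k}. par (f (x i)) (y i))"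
  proof (rule tuple_par)
    fix I assume "I \<subseteq> {..<k}" "card I \<le> r"
    from hyp[OF this] show "\<exists>f. lin_iso f \<and> (\<forall>i\<in>I. par (f (x i)) (y i))"
      using lifts by blast
  qed (use r in auto)
  then obtain g where g: "lin_iso g" "\<And>i. i < k \<Longrightarrow> par (g (x i)) (y i)" by auto
  obtain g' where g': "lin_iso g'" "\<And>v. g' (g v) = v" "\<And>v. g (g' v) = v"
    using g(1) by (metis lin_iso_inverse)
  obtain I where I: "I \<subseteq> x ` {..<k}" "finite I" "card I \<le> 2 * CARD('n) - 2"
    and eig: "\<And>f z. lin f \<Longrightarrow> (\<And>u. u \<in> I \<Longrightarrow> \<exists>c. f u = c *s u) \<Longrightarrow> z \<in> x ` {..<k} \<Longrightarrow> \<exists>c. f z = c *s z"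
    using few_determine_eigenvectors[OF n, of "x ` {..<k}"] by metis
  obtain J where J: "J \<subseteq> {..<k}" "inj_on x J" "I = x ` J" using I(1) by (metis subset_image_inj)
  have "card J = card I" using J by (simp add: card_image)
  then have "card J \<le> r" using I(3) r(2) by linarith
  then obtain A where A: "A \<in> lifts H" "\<And>j. j \<in> J \<Longrightarrow> par (x j v* A) (y j)" using hyp J(1) by blast
  have iso: "lin_iso (\<lambda>v. g' (v v* A))" using g'(1) lifts[OF A(1)] by (rule lin_iso_comp)
  have "\<exists>c. g' (u v* A) = c *s u" if u: "u \<in> I" for u
  proof -
    obtain j where j: "j \<in> J" "u = x j" using u J by blast
    then have "par (x j v* A) (g (x j))"
      using A(2) g(2) J(1) by (meson lessThan_iff par_sym par_trans subsetD)
    then have "par (g' (x j v* A)) (g' (g (x j)))" by (rule lin_iso_par[OF g'(1)])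
    then show ?thesis using j g'(2) by (auto simp: par_def)
  qed
  then have all: "\<exists>c. g' (x i v* A) = c *s x i" if "i < k" for i
    using eig[of "\<lambda>v. g' (v v* A)" "x i"] iso that by (auto simp: lin_iso_def)
  have "par (x i v* A) (y i)" if i: "i < k" for i
  proof -
    obtain c where c: "g' (x i v* A) = c *s x i" using all[OF i] by blast
    then have gc: "x i v* A = c *s g (x i)"
      using g'(3)[of "x i v* A"] g(1) by (simp add: lin_iso_def vec.linear_scale)
    have "par (x i v* A) (g (x i))"
    \<comment> \<open>The factor vanishes only if \<open>x i\<close> is zero, and then both sides
      are zero.\<close>
    proof (cases "c = 0")
      case True
      then have "x i v* A = 0" using gc by simp
      moreover have "inj (\<lambda>v. v v* A)" using lifts[OF A(1)] by (simp add: lin_iso_def)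
      ultimately have "x i = 0" using injD[of "\<lambda>v. v v* A" "x i" 0] by simp
      moreover have "g 0 = 0" using g(1) by (simp add: lin_iso_def vec.linear_0)
      ultimately show ?thesis by simp
    qed (use gc in \<open>simp add: par_scale\<close>)
    then show ?thesis using g(2)[OF i] by (rule par_trans)
  qed
  with A(1) show "\<exists>A\<in>lifts H. \<forall>i<k. par (x i v* A) (y i)" by blast
qed

text \<open>A further element \<open>a\<close> would yield the four elements 0, 1, \<open>a\<close>
  and -1, with \<open>a + 1\<close> in place of -1 in characteristic 2.\<close>

lemma field_le_3_cases:
  assumes "finite (UNIV :: 'a::field set)" "CARD('a) \<le> 3"
  shows "\<forall>a::'a. a = 0 \<or> a = 1 \<or> a = -1"
proof (rule ccontr)
  assume "\<not> ?thesis"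
  then obtain a :: 'a where a: "a \<noteq> 0" "a \<noteq> 1" "a \<noteq> -1" by blast
  have "card {0, 1, a, if (1::'a) = -1 then a + 1 else -1} = 4"
    using a by (auto simp: add_eq_0_iff2)
  then show False using card_mono[OF assms(1), of "{0, 1, a, if (1::'a) = -1 then a + 1 else -1}"] assms(2) by simp
qed

lemma field_ge_4_obtain:
  assumes "\<not> (finite (UNIV :: 'a::field set) \<and> CARD('a) \<le> 3)"
  obtains a b :: "'a::field" where "a \<noteq> 0" "a \<noteq> 1" "b \<noteq> 0" "b \<noteq> 1" "a \<noteq> b"
proof -
  have ne: "UNIV \<noteq> S" if "finite S" "card S \<le> 3" for S :: "'a set" using assms that by auto
  have "UNIV \<noteq> {0, 1 :: 'a}" by (rule ne) auto
  then obtain a :: 'a where a: "a \<noteq> 0" "a \<noteq> 1" by blast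
  have "UNIV \<noteq> {0, 1, a}" by (rule ne) (auto simp: card_insert_if)
  then obtain b where "b \<noteq> 0" "b \<noteq> 1" "b \<noteq> a" by blast
  with a that show thesis by blast
qed

text \<open>
  Without a primitive cube root of unity cubing is injective, so \<open>D\<close> contains distinct \<open>c, e \<noteq> 1\<close>.
  The parameters of \<open>relational_complexity_ge_line\<close> solve \<open>b = c a\<close> and \<open>1 - b = e (1 - a)\<close>.
\<close>

lemma relational_complexity_ge_5:
  fixes H :: "('a::field^'n^'n) set set"
  assumes n: "CARD('n) = 3" and H: "H \<subseteq> carrier PGL" and D: "\<And>A. A \<in> lifts H \<longleftrightarrow> det A \<in> D"
    and pow: "\<And>c. c \<noteq> 0 \<Longrightarrow> c ^ CARD('n) \<in> D" and d: "d \<noteq> 0" "d \<notin> D"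
  shows "enat (CARD('n) + 2) \<le> relational_complexity H proj_act proj_points"
proof -
  have D1: "1 \<in> D" using pow[of 1] by simp
  show ?thesis
  proof (cases "\<exists>\<omega>::'a. \<omega> ^ 3 = 1 \<and> \<omega> \<noteq> 1")
    case True
    then obtain \<omega> :: 'a where "\<omega> ^ 3 = 1" "\<omega> \<noteq> 1" by blast
    then show ?thesis using relational_complexity_ge_cube_root[OF n H _ D1] D by blast
  next
    case False
    have "\<not> (finite (UNIV :: 'a set) \<and> CARD('a) \<le> 3)"
    proof
      assume "finite (UNIV :: 'a set) \<and> CARD('a) \<le> 3"
      then have "d = 1 \<or> d = -1" using field_le_3_cases[where 'a='a] d(1) by blast
      then have "d ^ CARD('n) = d" using n by auto
      then show False using pow[OF d(1)] d(2) by simp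
    qed
    then obtain a b :: 'a where ab: "a \<noteq> 0" "a \<noteq> 1" "b \<noteq> 0" "b \<noteq> 1" "a \<noteq> b"
      by (rule field_ge_4_obtain)
    define c e where "c = a ^ 3" and "e = b ^ 3"
    have ce0: "c \<noteq> 0" "e \<noteq> 0" using ab by (auto simp: c_def e_def)
    have ce1: "c \<noteq> 1" "e \<noteq> 1" using ab False by (auto simp: c_def e_def)
    have "(a / b) ^ 3 \<noteq> 1" using ab False by (auto simp: divide_eq_1_iff)
    then have "c \<noteq> e" using ab by (auto simp: c_def e_def power_divide)
    then have ce: "c - e \<noteq> 0" by simp
    have eD: "e \<in> D" using pow[of b] ab n by (simp add: e_def)
    have "(b / a) ^ 3 \<in> D" using pow[of "b / a"] ab n by simp
    then have ecD: "e / c \<in> D" by (simp add: c_def e_def power_divide)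
    \<comment> \<open>With the parameters \<open>A\<close> and \<open>c * A\<close> the two
      determinants in \<open>relational_complexity_ge_line\<close> become \<open>e\<close> and
      \<open>e / c\<close>, both cubes and hence in \<open>D\<close>.\<close>
    define A where "A = (1 - e) / (c - e)"
    have A1: "1 - A = (c - 1) / (c - e)" using ce by (simp add: A_def field_simps)
    have B1: "1 - c * A = e * (c - 1) / (c - e)" using ce by (simp add: A_def field_simps)
    have "A \<noteq> 0" using ce ce1 by (simp add: A_def)
    moreover have "1 - A \<noteq> 0" using ce ce1 by (simp add: A1)
    moreover have "1 - c * A \<noteq> 0" using ce ce1 ce0 by (simp add: B1)
    moreover have "A \<noteq> c * A" using \<open>A \<noteq> 0\<close> ce1 by simp
    moreover have eq: "(1 - c * A) / (1 - A) = e" using ce ce1 by (simp add: A1 B1)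
    moreover have "A * (1 - c * A) / (c * A * (1 - A)) = e / c"
    proof -
      have "A * (1 - c * A) / (c * A * (1 - A)) = (1 - c * A) / (1 - A) / c"
        using \<open>A \<noteq> 0\<close> by (simp add: mult.commute mult.left_commute)
      then show ?thesis by (simp only: eq)
    qed
    ultimately show ?thesis
      using relational_complexity_ge_line[OF _ H _ D1, of A "c * A"] D n eD ecD ce0 by auto
  qed
qed

theorem theorem1:
  assumes "CARD('n::finite) \<ge> 3"
  shows
    "relational_complexity (carrier (PGL :: ('a::field^'n^'n) set monoid)) proj_act proj_points =
       (if finite (UNIV :: 'a set) \<and> CARD('a) \<le> 3 then enat CARD('n) else enat (CARD('n) + 2))
     \<and> (\<forall>H :: ('a^'n^'n) set set.
          subgroup H PGL \<and> PSL \<lhd> PGL\<lparr>carrier := H\<rparr> \<and> H \<subset> carrier PGL \<longrightarrow>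
          relational_complexity H proj_act proj_points =
            (if CARD('n) = 3 then enat (2 * CARD('n) - 1) else enat (2 * CARD('n) - 2)))"
proof (intro conjI allI impI)
  let ?RC = "relational_complexity (carrier (PGL :: ('a^'n^'n) set monoid)) proj_act proj_points"
  show "?RC = (if finite (UNIV :: 'a set) \<and> CARD('a) \<le> 3 then enat CARD('n) else enat (CARD('n) + 2))"
  proof (cases "finite (UNIV :: 'a set) \<and> CARD('a) \<le> 3")
    case True
    then have "?RC \<le> enat CARD('n)"
      using field_le_3_cases[where 'a='a] assms by (intro relational_complexity_PGL_le) auto
    moreover have "enat CARD('n) \<le> ?RC"
      using assms by (intro relational_complexity_PGL_ge_n) simp
    ultimately show ?thesis using True by simp
  next
    case False
    then obtain a b :: 'a where "a \<noteq> 0" "a \<noteq> 1" "b \<noteq> 0" "b \<noteq> 1" "a \<noteq> b"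
      by (rule field_ge_4_obtain)
    \<comment> \<open>For the full group all nonzero determinants occur, so any two distinct
      elements other than 0 and 1 will do.\<close>
    then have "enat (CARD('n) + 2) \<le> ?RC"
      using assms
      by (intro relational_complexity_ge_line[where D = "{c. c \<noteq> 0}" and a = a and b = b])
        (auto simp: lifts_PGL invertible_det_nz)
    moreover have "?RC \<le> enat (CARD('n) + 2)"
      using assms by (intro relational_complexity_PGL_le) auto
    ultimately have "?RC = enat (CARD('n) + 2)" by (rule antisym[rotated])
    then show ?thesis using False by simp
  qed
next
  fix H :: "('a^'n^'n) set set"
  assume H: "subgroup H PGL \<and> PSL \<lhd> PGL\<lparr>carrier := H\<rparr> \<and> H \<subset> carrier PGL"
  then have HP: "H \<subseteq> carrier PGL" by blast
  obtain D d where D: "\<And>A. A \<in> lifts H \<longleftrightarrow> det A \<in> D"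
    and mult: "\<And>a b. a \<in> D \<Longrightarrow> b \<in> D \<Longrightarrow> a * b \<in> D"
    and pow: "\<And>c. c \<noteq> 0 \<Longrightarrow> c ^ CARD('n) \<in> D" and d: "d \<noteq> 0" "d \<notin> D"
    using lifts_det[of H] H by (metis psubset_imp_subset less_irrefl)
  show "relational_complexity H proj_act proj_points =
      (if CARD('n) = 3 then enat (2 * CARD('n) - 1) else enat (2 * CARD('n) - 2))"
  proof (cases "CARD('n) = 3")
    case True
    have "relational_complexity H proj_act proj_points = enat (CARD('n) + 2)"
      using relational_complexity_subset_PGL_le[OF assms HP, of "CARD('n) + 2"] True
        relational_complexity_ge_5[OF True HP D pow d] by (intro antisym) auto
    then show ?thesis using True by simp
  next
    case False
    \<comment> \<open>From dimension four on, \<open>2 * CARD('n) - 2\<close> is at least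
      \<open>CARD('n) + 2\<close>, so both requirements of the upper bound are met.\<close>
    have "relational_complexity H proj_act proj_points = enat (2 * CARD('n) - 2)"
      using relational_complexity_subset_PGL_le[OF assms HP, of "2 * CARD('n) - 2"] False assms
        relational_complexity_ge_det[OF assms HP D mult pow d] by (intro antisym) auto
    then show ?thesis using False by simp
  qed
qed

end
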